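(* Let $\psi$ be a function satisfying the standing assumptions on $\psi$. If $(\xi,Q)$ is a random overlap structure (ROSt) that is robustly quasi-stationary for $\psi$, then it is also quasi-stationary under the free evolution $\Phi_\infty$ (with the same $\psi$).
   Context: **ROSt.** A mass-partition is a sequence $s=(s_i)_{i\in\mathbb{N}}$ with $s_1\ge s_2\ge\dots\ge0$ and $\sum_i s_i\le1$. $P_m$ is the space of mass-partitions with the metric $\max_i|s_i-s_i'|$. $\mathcal{Q}$ is the space of real symmetric positive semi-definite $\mathbb{N}\times\mathbb{N}$ matrices $Q=\{q_{ij}\}$ with $q_{ii}=1$, with the topology inherited from $[-1,1]^{\mathbb{N}\times\mathbb{N}}$. A ROSt is a random element $(\xi,Q)$ of $\Omega_{os}=P_m\times\mathcal{Q}$ for which $Q$ is almost surely positive definite (every finite principal submatrix is positive definite). **Standing assumptions on $\psi$.** $\psi:\mathbb{R}\to\mathbb{R}$ is Borel measurable, $\int_{\mathbb{R}}\frac{e^{-z^2/2}}{\sqrt{2\pi}}e^{\lambda\psi(z)}dz<\infty$ for every $\lambda\in\mathbb{R}$, and for $Y$ standard Gaussian the law of $\psi(Y)$ is absolutely continuous with respect to Lebesgue measure. **Evolutions.** Given $(\xi,Q)$ and a Gaussian field $\kappa=(\kappa_i)_{i\in\mathbb{N}}$, set $$\Phi_{\psi(\kappa)}(\xi,Q)=\left(\left(\frac{\xi_ie^{\psi(\kappa_i)}}{\sum_j\xi_je^{\psi(\kappa_j)}},i\in\mathbb{N}\right)_{\downarrow},\ \pi Q\pi^{-1}\right),$$ where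 $\downarrow$ is decreasing rearrangement (ties keep the original order) and $\pi$ is the corresponding permutation ($\pi(i)=m$ if the $i$-th weight becomes the $m$-th), $\pi Q\pi^{-1}=\{q_{\pi^{-1}(m)\pi^{-1}(n)}\}$. $\Phi_r$, $r\in\mathbb{N}$, is this map with $\kappa$, given $(\xi,Q)$, centered Gaussian with covariance $Q^{*r}=\{q_{ij}^r\}$. $\Phi_\infty$ (free evolution) is this map with $\kappa_i$ i.i.d. standard Gaussians independent of $(\xi,Q)$. $(\xi,Q)$ is quasi-stationary under $\Phi$ if $\Phi(\xi,Q)$ has the same law as $(\xi,Q)$; it is robustly quasi-stationary if it is quasi-stationary under $\Phi_r$ for $r=1$ and for infinitely many $r\in\mathbb{N}$. *)

theory Defs
  imports "HOL-Probability.Probability"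
begin

text \<open>Sequences and matrices are indexed by \<^typ>\<open>nat\<close>, starting from 0.\<close>

definition mass_partitions :: "(nat \<Rightarrow> real) set" where
  "mass_partitions = {s. decseq s \<and> (\<forall>i. 0 \<le> s i) \<and> summable s \<and> (\<Sum>i. s i) \<le> 1}"

text \<open>The supremum is a maximum on mass-partitions. The value outside is irrelevant; 0 makes the
  distance satisfy the requirement of \<^locale>\<open>Metric_space\<close> that it be nonnegative everywhere.\<close>

definition mass_dist :: "(nat \<Rightarrow> real) \<Rightarrow> (nat \<Rightarrow> real) \<Rightarrow> real" where
  "mass_dist s s' =
     (if s \<in> mass_partitions \<and> s' \<in> mass_partitions then SUP i. \<bar>s i - s' i\<bar> else 0)"

lemma bdd_above_mass_diff:
  assumes "s \<in> mass_partitions" "s' \<in> mass_partitions"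
  shows "bdd_above (range (\<lambda>i. \<bar>s i - s' i\<bar>))"
proof (rule bdd_aboveI2)
  fix i
  have "0 \<le> s i" "s i \<le> s 0" "0 \<le> s' i" "s' i \<le> s' 0"
    using assms by (auto simp: mass_partitions_def decseq_def)
  then show "\<bar>s i - s' i\<bar> \<le> s 0 + s' 0" by linarith
qed

lemma mass_diff_le_dist:
  assumes "s \<in> mass_partitions" "s' \<in> mass_partitions"
  shows "\<bar>s i - s' i\<bar> \<le> mass_dist s s'"
  using assms cSUP_upper[OF UNIV_I bdd_above_mass_diff[OF assms]] by (simp add: mass_dist_def)

interpretation mass: Metric_space mass_partitions mass_dist
proof
  fix x y :: "nat \<Rightarrow> real"
  show "0 \<le> mass_dist x y"
  proof (cases "x \<in> mass_partitions \<and> y \<in> mass_partitions")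
    case True
    then show ?thesis using mass_diff_le_dist[of x y 0] by linarith
  qed (auto simp: mass_dist_def)
  show "mass_dist x y = mass_dist y x"
    by (auto simp: mass_dist_def abs_minus_commute)
next
  fix x y assume xy: "x \<in> mass_partitions" "y \<in> mass_partitions"
  show "mass_dist x y = 0 \<longleftrightarrow> x = y"
  proof
    assume "mass_dist x y = 0"
    then have "\<bar>x i - y i\<bar> \<le> 0" for i using mass_diff_le_dist[OF xy, of i] by simp
    then show "x = y" by (intro ext) simp
  qed (use xy in \<open>simp add: mass_dist_def\<close>)
next
  fix x y z assume m: "x \<in> mass_partitions" "y \<in> mass_partitions" "z \<in> mass_partitions"
  have "\<bar>x i - z i\<bar> \<le> mass_dist x y + mass_dist y z" for i
    using mass_diff_le_dist[OF m(1,2), of i] mass_diff_le_dist[OF m(2,3), of i] by linarith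
  then have "(SUP i. \<bar>x i - z i\<bar>) \<le> mass_dist x y + mass_dist y z"
    by (intro cSUP_least) auto
  then show "mass_dist x z \<le> mass_dist x y + mass_dist y z"
    using m by (simp add: mass_dist_def)
qed

definition mass_partition_space :: "(nat \<Rightarrow> real) measure" where
  "mass_partition_space =
     sigma mass_partitions {U. openin mass.mtopology U}"

definition psd_matrix :: "(nat \<Rightarrow> nat \<Rightarrow> real) \<Rightarrow> bool" where
  "psd_matrix C \<longleftrightarrow> (\<forall>i j. C i j = C j i) \<and>
     (\<forall>I t. finite I \<longrightarrow> 0 \<le> (\<Sum>i\<in>I. \<Sum>j\<in>I. t i * t j * C i j))"

definition pd_matrix :: "(nat \<Rightarrow> nat \<Rightarrow> real) \<Rightarrow> bool" where
  "pd_matrix C \<longleftrightarrow> (\<forall>i j. C i j = C j i) \<and>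
     (\<forall>I t. finite I \<longrightarrow> (\<exists>i\<in>I. t i \<noteq> 0) \<longrightarrow> 0 < (\<Sum>i\<in>I. \<Sum>j\<in>I. t i * t j * C i j))"

definition overlap_matrices :: "(nat \<Rightarrow> nat \<Rightarrow> real) set" where
  "overlap_matrices = {Q. psd_matrix Q \<and> (\<forall>i. Q i i = 1)}"

text \<open>Here \<^const>\<open>borel\<close> refers to the product topology on functions, i.e. entrywise convergence.\<close>

definition overlap_matrix_space :: "(nat \<Rightarrow> nat \<Rightarrow> real) measure" where
  "overlap_matrix_space = restrict_space borel overlap_matrices"

type_synonym overlap_structure = "(nat \<Rightarrow> real) \<times> (nat \<Rightarrow> nat \<Rightarrow> real)"

definition overlap_space :: "overlap_structure measure" where
  "overlap_space = mass_partition_space \<Otimes>\<^sub>M overlap_matrix_space"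

definition ROSt :: "'a measure \<Rightarrow> ('a \<Rightarrow> overlap_structure) \<Rightarrow> bool" where
  "ROSt M X \<longleftrightarrow> prob_space M \<and> X \<in> M \<rightarrow>\<^sub>M overlap_space \<and> (AE \<omega> in M. pd_matrix (snd (X \<omega>)))"

definition admissible :: "(real \<Rightarrow> real) \<Rightarrow> bool" where
  "admissible \<psi> \<longleftrightarrow> \<psi> \<in> borel_measurable borel \<and>
     (\<forall>l. integrable lborel (\<lambda>z. std_normal_density z * exp (l * \<psi> z))) \<and>
     absolutely_continuous lborel (distr (density lborel std_normal_density) borel \<psi>)"

abbreviation field_space :: "(nat \<Rightarrow> real) measure" where
  "field_space \<equiv> \<Pi>\<^sub>M i\<in>UNIV. borel"

text \<open>The centered normal law with variance \<open>v \<ge> 0\<close>; \<^const>\<open>normal_density\<close> takes the standard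
  deviation, and is not a density in the degenerate case.\<close>

definition centered_normal :: "real \<Rightarrow> real measure" where
  "centered_normal v =
     (if v = 0 then return borel 0 else density lborel (normal_density 0 (sqrt v)))"

definition centered_gaussian_field :: "(nat \<Rightarrow> nat \<Rightarrow> real) \<Rightarrow> (nat \<Rightarrow> real) measure \<Rightarrow> bool" where
  "centered_gaussian_field C \<gamma> \<longleftrightarrow> sets \<gamma> = sets field_space \<and>
     (\<forall>I t. finite I \<longrightarrow> distr \<gamma> borel (\<lambda>\<kappa>. \<Sum>i\<in>I. t i * \<kappa> i) =
        centered_normal (\<Sum>i\<in>I. \<Sum>j\<in>I. t i * t j * C i j))"

definition hadamard_power :: "(nat \<Rightarrow> nat \<Rightarrow> real) \<Rightarrow> nat \<Rightarrow> nat \<Rightarrow> nat \<Rightarrow> real" where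
  "hadamard_power Q r = (\<lambda>i j. Q i j ^ r)"

text \<open>\<open>rearrangement w i\<close> is the position of the \<open>i\<close>-th weight after decreasing rearrangement, ties
  keeping the original order: it counts the indices placed before \<open>i\<close>. If \<open>w i = \<xi> i * c i\<close> is
  summable with \<open>\<xi>\<close> a mass-partition and all \<open>c i > 0\<close>, these counts are finite, the zero weights form
  a tail, and \<open>rearrangement w\<close> is a permutation of the indices.\<close>

definition rearrangement :: "(nat \<Rightarrow> real) \<Rightarrow> nat \<Rightarrow> nat" where
  "rearrangement w i = card {j. w j > w i \<or> (w j = w i \<and> j < i)}"

definition rearrange :: "(nat \<Rightarrow> real) \<Rightarrow> (nat \<Rightarrow> nat \<Rightarrow> real) \<Rightarrow> overlap_structure" where
  "rearrange w Q = (let \<rho> = inv (rearrangement w) in (\<lambda>m. w (\<rho> m), \<lambda>m n. Q (\<rho> m) (\<rho> n)))"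

text \<open>If the total mass is infinite, which happens with probability zero in every evolution below,
  the structure is left as it is. If all weights vanish, the division by zero leaves them zero and
  the structure is again unchanged.\<close>

definition evolve :: "(real \<Rightarrow> real) \<Rightarrow> (nat \<Rightarrow> real) \<Rightarrow> overlap_structure \<Rightarrow> overlap_structure" where
  "evolve \<psi> \<kappa> = (\<lambda>(\<xi>, Q).
     if summable (\<lambda>j. \<xi> j * exp (\<psi> (\<kappa> j)))
     then rearrange (\<lambda>i. \<xi> i * exp (\<psi> (\<kappa> i)) / (\<Sum>j. \<xi> j * exp (\<psi> (\<kappa> j)))) Q
     else (\<xi>, Q))"

text \<open>The law of \<open>evolve \<psi> \<kappa> (\<xi>, Q)\<close> when \<open>(\<xi>, Q)\<close> has law \<open>\<mu>\<close> and \<open>K (\<xi>, Q)\<close> is the conditional law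
  of \<open>\<kappa>\<close> given \<open>(\<xi>, Q)\<close>.\<close>

definition evolved_law ::
  "(real \<Rightarrow> real) \<Rightarrow> (overlap_structure \<Rightarrow> (nat \<Rightarrow> real) measure) \<Rightarrow> overlap_structure measure
    \<Rightarrow> overlap_structure measure" where
  "evolved_law \<psi> K \<mu> = \<mu> \<bind> (\<lambda>s. distr (K s) overlap_space (\<lambda>\<kappa>. evolve \<psi> \<kappa> s))"

text \<open>\<open>K\<close> is a regular conditional law, given \<open>X\<close>, of a field that is conditionally centered Gaussian
  with covariance the \<open>r\<close>-th entrywise power of the overlap matrix. Two such kernels agree almost
  surely, because a law on the field space is determined by its finite linear combinations.\<close>

definition gaussian_kernel ::
  "nat \<Rightarrow> 'a measure \<Rightarrow> ('a \<Rightarrow> overlap_structure) \<Rightarrow> (overlap_structure \<Rightarrow> (nat \<Rightarrow> real) measure)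
    \<Rightarrow> bool" where
  "gaussian_kernel r M X K \<longleftrightarrow> K \<in> overlap_space \<rightarrow>\<^sub>M prob_algebra field_space \<and>
     (AE \<omega> in M. centered_gaussian_field (hadamard_power (snd (X \<omega>)) r) (K (X \<omega>)))"

definition quasi_stationary ::
  "(real \<Rightarrow> real) \<Rightarrow> nat \<Rightarrow> 'a measure \<Rightarrow> ('a \<Rightarrow> overlap_structure) \<Rightarrow> bool" where
  "quasi_stationary \<psi> r M X \<longleftrightarrow> (\<exists>K. gaussian_kernel r M X K \<and>
     evolved_law \<psi> K (distr M overlap_space X) = distr M overlap_space X)"

definition robustly_quasi_stationary ::
  "(real \<Rightarrow> real) \<Rightarrow> 'a measure \<Rightarrow> ('a \<Rightarrow> overlap_structure) \<Rightarrow> bool" where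
  "robustly_quasi_stationary \<psi> M X \<longleftrightarrow>
     quasi_stationary \<psi> 1 M X \<and> infinite {r. quasi_stationary \<psi> r M X}"

definition free_field :: "(nat \<Rightarrow> real) measure" where
  "free_field = (\<Pi>\<^sub>M i\<in>UNIV. density lborel std_normal_density)"

definition freely_quasi_stationary ::
  "(real \<Rightarrow> real) \<Rightarrow> 'a measure \<Rightarrow> ('a \<Rightarrow> overlap_structure) \<Rightarrow> bool" where
  "freely_quasi_stationary \<psi> M X \<longleftrightarrow>
     evolved_law \<psi> (\<lambda>_. free_field) (distr M overlap_space X) = distr M overlap_space X"

end

theory Submission
  imports Defs
begin

text \<open>Since \<open>Q\<close> is positive definite with unit diagonal, \<open>\<bar>Q i j\<bar> < 1\<close> off the diagonal, so the entrywise
  powers of \<open>Q\<close> tend to the identity along the infinitely many \<open>r\<close> of the hypothesis. It suffices that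
  for fixed \<open>(\<xi>, Q)\<close> the law of the evolved structure, tested against functions of finitely many
  weights and overlaps, then converges to its law under the free evolution.

  As \<open>\<psi>\<close> is merely measurable, weak convergence of the fields is not enough; but the law of the first
  \<open>n\<close> coordinates converges in total variation. For a covariance close to the identity, the field is
  an explicit combination of i.i.d. normals: a rescaled free field plus an independent perturbation,
  so that Scheffe's lemma applies to its conditional density.

  Replacing \<open>\<xi>\<close> by its first \<open>n\<close> entries changes the top of the evolved structure little, uniformly in
  \<open>r\<close>: all coordinates are standard normal whatever the covariance, hence the first \<open>m\<close> reweighted
  masses exceed some \<open>\<delta>\<close> with high probability while the mean of the total reweighted mass beyond \<open>n\<close> is
  proportional to \<open>\<Sum>j\<ge>n. \<xi> j\<close>. Ties are harmless, as they are broken by a fixed rule.\<close>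

text \<open>The passage to finitely many coordinates cannot be avoided. If all off-diagonal overlaps
  equal some rho in (0, 1), the averages of the coordinates have a nonzero limit almost surely for
  every power r, but limit 0 for the free field, so the infinite fields stay mutually singular. This
  fixes the order of choices: the truncation level n depends on the structure, the test function and
  the tolerance, but not on the field; only then does r grow.

  Truncation changes the normalisation and so perturbs every weight, while the leading overlaps
  remain literally the same entries. The test functions are therefore Lipschitz in the weights and
  arbitrary Borel indicators in the overlaps.

  A Gaussian field is specified only through the laws of its linear combinations, so identifying it
  with an explicit construction takes a Cramer-Wold argument.

  Quasi-stationarity makes the integrals of a test function along the chosen powers a constant
  sequence, and its limit is the integral for the free evolution.\<close>

section \<open>Determination of cylinder laws by linear combinations\<close>

text \<open>Normalised by their common mass, \<open>D\<close> and \<open>E\<close> become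
  probability densities under which \<open>X\<close> and \<open>Y\<close> have the same
  characteristic function: the phases 0 and \<open>-pi/2\<close> give its real and imaginary parts.
  If the mass is 0, both sides vanish.\<close>

lemma weighted_levy_uniqueness:
  fixes X :: "'a \<Rightarrow> real" and D :: "'a \<Rightarrow> real" and Y E :: "'b \<Rightarrow> real"
  assumes "prob_space M" "prob_space N"
    and [measurable]: "X \<in> borel_measurable M" "D \<in> borel_measurable M"
      "Y \<in> borel_measurable N" "E \<in> borel_measurable N"
    and D: "\<And>x. 0 \<le> D x" "\<And>x. D x \<le> B" and E: "\<And>x. 0 \<le> E x" "\<And>x. E x \<le> B"
    and eq: "\<And>s c. (\<integral>x. D x * cos (c + s * X x) \<partial>M) = (\<integral>x. E x * cos (c + s * Y x) \<partial>N)"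
    and A [measurable]: "A \<in> sets borel"
  shows "(\<integral>x. D x * indicator A (X x) \<partial>M) = (\<integral>x. E x * indicator A (Y x) \<partial>N)"
proof -
  interpret M: prob_space M by fact
  interpret N: prob_space N by fact
  have B: "0 \<le> B" using D[of undefined] by simp
  have intM: "integrable M (\<lambda>x. D x * f x)" if [measurable]: "f \<in> borel_measurable M" "\<And>x. \<bar>f x\<bar> \<le> 1" for f
    using D B that(2) by (intro M.integrable_const_bound[of _ B])
      (auto simp: abs_mult intro!: AE_I2 mult_mono[of _ B _ 1, simplified])
  have intN: "integrable N (\<lambda>x. E x * f x)" if [measurable]: "f \<in> borel_measurable N" "\<And>x. \<bar>f x\<bar> \<le> 1" for f
    using E B that(2) by (intro N.integrable_const_bound[of _ B])
      (auto simp: abs_mult intro!: AE_I2 mult_mono[of _ B _ 1, simplified])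
  have iD: "integrable M D" using intM[of "\<lambda>_. 1"] by simp
  have iE: "integrable N E" using intN[of "\<lambda>_. 1"] by simp
  define m where "m = (\<integral>x. D x \<partial>M)"
  have mE: "m = (\<integral>x. E x \<partial>N)" using eq[of 0 0] by (simp add: m_def)
  have m0: "m \<ge> 0" using D by (simp add: m_def)
  show ?thesis
  proof (cases "m = 0")
    case True
    have "(\<integral>x. D x * indicator A (X x) \<partial>M) \<le> (\<integral>x. D x \<partial>M)"
      by (intro integral_mono intM iD) (auto simp: indicator_def D)
    moreover have "(\<integral>x. D x * indicator A (X x) \<partial>M) \<ge> 0" using D by (intro integral_nonneg_AE) auto
    moreover have "(\<integral>x. E x * indicator A (Y x) \<partial>N) \<le> (\<integral>x. E x \<partial>N)"
      by (intro integral_mono intN iE) (auto simp: indicator_def E)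
    moreover have "(\<integral>x. E x * indicator A (Y x) \<partial>N) \<ge> 0" using E by (intro integral_nonneg_AE) auto
    ultimately show ?thesis using True mE by (simp add: m_def)
  next
    case False
    then have m: "m > 0" using m0 by simp
    define M' where "M' = distr (density M (\<lambda>x. D x / m)) borel X"
    define N' where "N' = distr (density N (\<lambda>x. E x / m)) borel Y"
    have "prob_space (density M (\<lambda>x. D x / m))"
    proof (rule prob_spaceI)
      have "(\<integral>\<^sup>+x. ennreal (D x / m) \<partial>M) = ennreal (\<integral>x. D x / m \<partial>M)"
        using iD D m by (intro nn_integral_eq_integral) auto
      then show "emeasure (density M (\<lambda>x. D x / m)) (space (density M (\<lambda>x. D x / m))) = 1"
        using m by (simp add: emeasure_density m_def[symmetric] cong: nn_integral_cong)
    qed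
    then have M': "real_distribution M'"
      unfolding M'_def by (intro prob_space.real_distribution_distr) auto
    have "prob_space (density N (\<lambda>x. E x / m))"
    proof (rule prob_spaceI)
      have "(\<integral>\<^sup>+x. ennreal (E x / m) \<partial>N) = ennreal (\<integral>x. E x / m \<partial>N)"
        using iE E m by (intro nn_integral_eq_integral) auto
      then show "emeasure (density N (\<lambda>x. E x / m)) (space (density N (\<lambda>x. E x / m))) = 1"
        using m by (simp add: emeasure_density mE[symmetric] cong: nn_integral_cong)
    qed
    then have N': "real_distribution N'"
      unfolding N'_def by (intro prob_space.real_distribution_distr) auto
    have IM: "(\<integral>x. f x \<partial>M') = (\<integral>x. D x * f (X x) \<partial>M) / m" if [measurable]: "f \<in> borel_measurable borel" for f :: "real \<Rightarrow> real"
      unfolding M'_def using D m by (simp add: integral_distr integral_density)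
    have IN: "(\<integral>x. f x \<partial>N') = (\<integral>x. E x * f (Y x) \<partial>N) / m" if [measurable]: "f \<in> borel_measurable borel" for f :: "real \<Rightarrow> real"
      unfolding N'_def using E m by (simp add: integral_distr integral_density)
    have charI: "char P s = Complex (\<integral>x. cos (s * x) \<partial>P) (\<integral>x. cos (- pi/2 + s * x) \<partial>P)"
      if "real_distribution P" for P s
    proof -
      interpret P: real_distribution P by fact
      have i: "integrable P (\<lambda>x. iexp (s * x))" by (rule P.integrable_iexp) auto
      have "sin y = cos (- pi/2 + y)" for y :: real
        by (simp add: sin_cos_eq) (metis cos_minus minus_diff_eq)
      then show ?thesis unfolding char_def
        using i by (intro complex_eqI) (simp_all flip: integral_Re integral_Im add: Re_exp Im_exp)
    qed
    have "char M' s = char N' s" for s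
      unfolding charI[OF M'] charI[OF N']
      using eq[of 0 s] eq[of "-pi/2" s] by (simp add: IM IN)
    then have "M' = N'" by (intro Levy_uniqueness M' N' ext)
    then have "(\<integral>x. indicator A x \<partial>M') = (\<integral>x. indicator A x \<partial>N' :: real)" by (rule arg_cong)
    then show ?thesis
      unfolding IM[OF borel_measurable_indicator[OF A]] IN[OF borel_measurable_indicator[OF A]]
      using m by simp
  qed
qed

text \<open>The trigonometric factor, which encodes the coordinates not yet localised, is made nonnegative
  by adding 1, so that the one-dimensional uniqueness theorem of Levy localises one further coordinate.\<close>

lemma finite_cramer_wold:
  fixes M N :: "(nat \<Rightarrow> real) measure"
  assumes M: "prob_space M" and N: "prob_space N"
    and sM: "sets M = sets field_space" and sN: "sets N = sets field_space"
    and eq: "\<And>t. distr M borel (\<lambda>x. \<Sum>i<n. t i * x i) = distr N borel (\<lambda>x. \<Sum>i<n. t i * x i)"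
    and "k \<le> n" and "\<And>i. A i \<in> sets borel"
  shows "(\<integral>x. (\<Prod>i<k. indicator (A i) (x i)) * cos (b + (\<Sum>i\<in>{k..<n}. t i * x i)) \<partial>M)
       = (\<integral>x. (\<Prod>i<k. indicator (A i) (x i)) * cos (b + (\<Sum>i\<in>{k..<n}. t i * x i)) \<partial>N)"
  using \<open>k \<le> n\<close>
proof (induction k arbitrary: t b)
  note sM[measurable_cong] sN[measurable_cong]
  {
    case 0
    have "(\<integral>x. cos (b + (\<Sum>i<n. t i * x i)) \<partial>M) = (\<integral>y. cos (b + y) \<partial>distr M borel (\<lambda>x. \<Sum>i<n. t i * x i))"
      by (subst integral_distr) auto
    also have "\<dots> = (\<integral>x. cos (b + (\<Sum>i<n. t i * x i)) \<partial>N)"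
      unfolding eq by (subst integral_distr) auto
    finally show ?case by (simp add: atLeast0LessThan)
  next
    case (Suc k)
    note [measurable] = assms(7)
    define W :: "(nat \<Rightarrow> real) \<Rightarrow> real" where "W x = (\<Prod>i<k. indicator (A i) (x i))" for x
    have [measurable]: "W \<in> borel_measurable field_space" unfolding W_def by measurable
    have W: "0 \<le> W x" "W x \<le> 1" for x unfolding W_def
      by (auto intro!: prod_nonneg prod_le_1 simp: indicator_def)
    define IM where "IM f = (\<integral>x. W x * f x \<partial>M)" for f
    define IN where "IN f = (\<integral>x. W x * f x \<partial>N)" for f
    have bdd: "\<bar>W x * f x\<bar> \<le> 1" if "\<And>x. \<bar>f x\<bar> \<le> 1" for f x
      using W[of x] that[of x] by (simp add: abs_mult mult_le_one)
    have iM: "integrable M (\<lambda>x. W x * f x)" if "f \<in> borel_measurable field_space" "\<And>x. \<bar>f x\<bar> \<le> 1" for f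
      using that by (intro finite_measure.integrable_const_bound[OF prob_space.finite_measure[OF M], of _ 1])
        (auto simp: bdd)
    have iN: "integrable N (\<lambda>x. W x * f x)" if "f \<in> borel_measurable field_space" "\<And>x. \<bar>f x\<bar> \<le> 1" for f
      using that by (intro finite_measure.integrable_const_bound[OF prob_space.finite_measure[OF N], of _ 1])
        (auto simp: bdd)
    have split: "(\<Sum>i\<in>{k..<n}. u i * x i) = u k * x k + (\<Sum>i\<in>{Suc k..<n}. u i * x i)" for u x :: "nat \<Rightarrow> real"
      using Suc.prems by (simp add: sum.atLeast_Suc_lessThan)
    \<comment> \<open>Overwriting the frequency of coordinate \<open>k\<close> makes it a free
      parameter \<open>s\<close>, which the one-dimensional uniqueness argument varies.\<close>
    have IH: "IM (\<lambda>x. cos (c + s * x k + (\<Sum>i\<in>{Suc k..<n}. u i * x i)))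
            = IN (\<lambda>x. cos (c + s * x k + (\<Sum>i\<in>{Suc k..<n}. u i * x i)))" for c s u
      using Suc.IH[of c "u(k := s)"] Suc.prems
      by (simp add: IM_def IN_def W_def split algebra_simps)
    have IH0: "IM (\<lambda>x. cos (c + s * x k)) = IN (\<lambda>x. cos (c + s * x k))" for c s
      using IH[of c s "\<lambda>_. 0"] by simp
    have key: "IM (\<lambda>x. (1 + cos (b + (\<Sum>i\<in>{Suc k..<n}. t i * x i))) * indicator (A k) (x k))
       = IN (\<lambda>x. (1 + cos (b + (\<Sum>i\<in>{Suc k..<n}. t i * x i))) * indicator (A k) (x k))" for b t
    proof -
      define \<theta> where "\<theta> x = b + (\<Sum>i\<in>{Suc k..<n}. t i * x i)" for x
      have [measurable]: "\<theta> \<in> borel_measurable field_space" unfolding \<theta>_def by measurable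
      have c: "0 \<le> 1 + cos (\<theta> x)" "1 + cos (\<theta> x) \<le> 2" for x
        using cos_ge_minus_one[of "\<theta> x"] cos_le_one[of "\<theta> x"] by linarith+
      have le2: "W x * (1 + cos (\<theta> x)) \<le> 2" for x
        using mult_mono[OF W(2)[of x] c(2)[of x]] c by simp
      \<comment> \<open>Product-to-sum formula: a product of two cosines becomes cosines of a single
        linear form with phases \<open>b + c\<close> and \<open>b - c\<close>, which
        \<open>IH\<close> covers.\<close>
      have exp: "W x * (1 + cos (\<theta> x)) * cos (c + s * x k)
        = W x * cos (c + s * x k) + (W x * cos ((b + c) + s * x k + (\<Sum>i\<in>{Suc k..<n}. t i * x i))) / 2
          + (W x * cos ((b - c) + (- s) * x k + (\<Sum>i\<in>{Suc k..<n}. t i * x i))) / 2" for c s x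
      proof -
        have "(b + c) + s * x k + (\<Sum>i\<in>{Suc k..<n}. t i * x i) = \<theta> x + (c + s * x k)"
             "(b - c) + (- s) * x k + (\<Sum>i\<in>{Suc k..<n}. t i * x i) = \<theta> x - (c + s * x k)"
          by (simp_all add: \<theta>_def)
        moreover have "w * (1 + cos p) * cos y = w * cos y + (w * cos (p + y)) / 2 + (w * cos (p - y)) / 2"
          for w p y :: real
          by (simp add: cos_add cos_diff field_simps)
        ultimately show ?thesis by (simp only:)
      qed
      have "(\<integral>x. (W x * (1 + cos (\<theta> x))) * indicator (A k) (x k) \<partial>M)
          = (\<integral>x. (W x * (1 + cos (\<theta> x))) * indicator (A k) (x k) \<partial>N)"
      proof (rule weighted_levy_uniqueness[OF M N, where B = 2])
        fix s c
        have "(\<integral>x. W x * (1 + cos (\<theta> x)) * cos (c + s * x k) \<partial>M)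
           = IM (\<lambda>x. cos (c + s * x k)) + IM (\<lambda>x. cos ((b + c) + s * x k + (\<Sum>i\<in>{Suc k..<n}. t i * x i))) / 2
            + IM (\<lambda>x. cos ((b - c) + (- s) * x k + (\<Sum>i\<in>{Suc k..<n}. t i * x i))) / 2"
          unfolding exp IM_def by (simp add: iM)
        also have "\<dots> = IN (\<lambda>x. cos (c + s * x k)) + IN (\<lambda>x. cos ((b + c) + s * x k + (\<Sum>i\<in>{Suc k..<n}. t i * x i))) / 2
            + IN (\<lambda>x. cos ((b - c) + (- s) * x k + (\<Sum>i\<in>{Suc k..<n}. t i * x i))) / 2"
          by (simp only: IH IH0)
        also have "\<dots> = (\<integral>x. W x * (1 + cos (\<theta> x)) * cos (c + s * x k) \<partial>N)"
          unfolding exp IN_def by (simp add: iN)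
        finally show "(\<integral>x. W x * (1 + cos (\<theta> x)) * cos (c + s * x k) \<partial>M)
          = (\<integral>x. W x * (1 + cos (\<theta> x)) * cos (c + s * x k) \<partial>N)" .
      qed (use W c le2 in auto)
      then show ?thesis by (simp add: IM_def IN_def \<theta>_def mult.assoc)
    qed
    let ?C = "\<lambda>x. cos (b + (\<Sum>i\<in>{Suc k..<n}. t i * x i)) * indicator (A k) (x k)"
    let ?I = "\<lambda>x. indicator (A k) (x k)"
    have "IM (\<lambda>x. (1 + cos (b + (\<Sum>i\<in>{Suc k..<n}. t i * x i))) * indicator (A k) (x k)) = IM ?I + IM ?C"
      unfolding IM_def
      by (subst Bochner_Integration.integral_add[symmetric])
        (auto intro!: iM simp: algebra_simps indicator_def)
    moreover have "IN (\<lambda>x. (1 + cos (b + (\<Sum>i\<in>{Suc k..<n}. t i * x i))) * indicator (A k) (x k)) = IN ?I + IN ?C"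
      unfolding IN_def
      by (subst Bochner_Integration.integral_add[symmetric])
        (auto intro!: iN simp: algebra_simps indicator_def)
    \<comment> \<open>At zero frequencies the trigonometric factor is the constant 2, which isolates
      the plain indicator; subtracting it removes the added 1.\<close>
    moreover have "IM ?I = IN ?I"
      using key[of 0 "\<lambda>_. 0"] by (simp add: IM_def IN_def mult.left_commute[of _ 2])
    ultimately have "IM ?C = IN ?C" using key[of b t] by simp
    then show ?case by (simp add: IM_def IN_def W_def mult_ac)
  }
qed

text \<open>The integral depends only on the marginal on \<open>{..<n}\<close>. The marginals agree
  on rectangles by the case \<open>k = n\<close> of \<open>finite_cramer_wold\<close>, where no
  coordinate is left in the cosine, and rectangles determine a finite product law.\<close>

lemma cylinder_integral_eq:
  fixes M N :: "(nat \<Rightarrow> real) measure" and H :: "(nat \<Rightarrow> real) \<Rightarrow> real"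
  assumes M: "prob_space M" and N: "prob_space N"
    and sM: "sets M = sets field_space" and sN: "sets N = sets field_space"
    and eq: "\<And>t. distr M borel (\<lambda>x. \<Sum>i<n. t i * x i) = distr N borel (\<lambda>x. \<Sum>i<n. t i * x i)"
    and H [measurable]: "H \<in> borel_measurable field_space"
    and cyl: "\<And>x y. (\<And>i. i < n \<Longrightarrow> x i = y i) \<Longrightarrow> H x = H y"
  shows "(\<integral>x. H x \<partial>M) = (\<integral>x. H x \<partial>N)"
proof -
  note sM[measurable_cong] sN[measurable_cong]
  let ?R = "\<lambda>x::nat \<Rightarrow> real. restrict x {..<n}"
  let ?P = "\<Pi>\<^sub>M i\<in>{..<n}. borel :: real measure"
  have R [measurable]: "?R \<in> field_space \<rightarrow>\<^sub>M ?P" by measurable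
  have rect: "emeasure (distr L ?P ?R) (PiE {..<n} A) = ennreal (\<integral>x. (\<Prod>i<n. indicator (A i) (x i)) \<partial>L)"
    if L: "prob_space L" and sL [measurable_cong]: "sets L = sets field_space"
      and A [measurable]: "\<And>i. A i \<in> sets borel" for L A
  proof -
    have sp: "space L = UNIV" using sets_eq_imp_space_eq[OF sL] by (simp add: space_PiM)
    have "emeasure (distr L ?P ?R) (PiE {..<n} A) = emeasure L (?R -` PiE {..<n} A \<inter> space L)"
      by (rule emeasure_distr) (auto intro!: sets_PiM_I_finite)
    also have "?R -` PiE {..<n} A \<inter> space L = {x \<in> space L. \<forall>i\<in>{..<n}. x i \<in> A i}"
      using sp by (auto simp: PiE_iff)
    also have "emeasure L \<dots> = (\<integral>x. indicator {x \<in> space L. \<forall>i\<in>{..<n}. x i \<in> A i} x \<partial>L)"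
      using finite_measure.emeasure_eq_measure[OF prob_space.finite_measure[OF L]] by simp
    also have "\<dots> = (\<integral>x. (\<Prod>i<n. indicator (A i) (x i)) \<partial>L)"
      by (intro arg_cong[of _ _ ennreal] Bochner_Integration.integral_cong)
        (auto simp: sp indicator_def prod_zero_iff)
    finally show ?thesis .
  qed
  have marg: "distr M ?P ?R = distr N ?P ?R"
  proof (rule measure_eqI_PiM_finite)
    fix A assume A: "\<And>i. i \<in> {..<n} \<Longrightarrow> A i \<in> sets (borel :: real measure)"
    define A' where "A' i = (if i < n then A i else {})" for i
    have A': "A' i \<in> sets borel" for i using A by (simp add: A'_def)
    have "PiE {..<n} A = PiE {..<n} A'" by (intro PiE_cong) (simp add: A'_def)
    then show "emeasure (distr M ?P ?R) (PiE {..<n} A) = emeasure (distr N ?P ?R) (PiE {..<n} A)"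
      using finite_cramer_wold[OF M N sM sN eq order_refl A', where b = 0 and t = "\<lambda>_. 0"]
      by (simp add: rect[OF M sM A'] rect[OF N sN A'])
  next
    show "range (\<lambda>_::nat. space ?P) \<subseteq> prod_algebra {..<n} (\<lambda>_. borel)"
      by (auto simp: space_PiM intro!: prod_algebraI_finite)
    show "(\<Union>i::nat. space ?P) = space ?P" by simp
    show "emeasure (distr M ?P ?R) (space ?P) \<noteq> \<infinity>"
      using prob_space.emeasure_space_1[OF prob_space.prob_space_distr[OF M, of ?R ?P]] by simp
  qed auto
  have ext [measurable]: "(\<lambda>y i. if i < n then y i else 0) \<in> ?P \<rightarrow>\<^sub>M field_space"
  proof (rule measurable_PiM_single')
    fix i :: nat
    show "(\<lambda>y. if i < n then y i else 0) \<in> borel_measurable ?P"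
      by (cases "i < n") auto
  qed (auto simp: space_PiM)
  have H_marg: "(\<integral>x. H x \<partial>L) = (\<integral>y. H (\<lambda>i. if i < n then y i else 0) \<partial>distr L ?P ?R)"
    if [measurable_cong]: "sets L = sets field_space" for L
    by (subst integral_distr) (auto intro!: Bochner_Integration.integral_cong cyl)
  show ?thesis unfolding H_marg[OF sM] H_marg[OF sN] marg ..
qed

section \<open>Gaussian fields with covariance close to the identity\<close>

lemma prob_space_std_normal [simp]: "prob_space std_normal_distribution"
  by (rule prob_space_normal_density) simp

lemma distr_std_normal_affine:
  assumes "\<sigma> > 0"
  shows "distr std_normal_distribution lborel (\<lambda>x. \<beta> + \<sigma> * x) = density lborel (normal_density \<beta> \<sigma>)"
proof -
  interpret prob_space std_normal_distribution by simp
  have "distributed std_normal_distribution lborel (\<lambda>x. x) std_normal_density"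
    by (auto simp: distributed_def intro!: measure_eqI simp: emeasure_distr)
  from normal_density_affine[OF this, of \<sigma> \<beta>] assms
  show ?thesis by (auto dest: distributed_distr_eq_density)
qed

lemma real_distribution_centered_normal:
  assumes "v \<ge> 0"
  shows "real_distribution (centered_normal v)"
proof (cases "v = 0")
  case False
  then interpret prob_space "density lborel (normal_density 0 (sqrt v))"
    using assms by (intro prob_space_normal_density) auto
  show ?thesis using False by (auto simp: centered_normal_def real_distribution_def real_distribution_axioms_def prob_space_axioms)
next
  case True
  then show ?thesis
    by (auto simp: centered_normal_def real_distribution_def real_distribution_axioms_def prob_space_return)
qed

text \<open>Variance 0 is included because it occurs for the zero linear combination.\<close>

lemma char_centered_normal:
  assumes "v \<ge> 0"
  shows "char (centered_normal v) s = complex_of_real (exp (- (s\<^sup>2 * v) / 2))"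
proof (cases "v = 0")
  case True
  then show ?thesis by (simp add: centered_normal_def char_def integral_return)
next
  case False
  then have "sqrt v > 0" using assms by simp
  then have "char (centered_normal v) s = char (distr std_normal_distribution lborel (\<lambda>x. 0 + sqrt v * x)) s"
    using False by (simp only: distr_std_normal_affine) (simp add: centered_normal_def)
  also have "\<dots> = (CLINT x|std_normal_distribution. iexp (s * (sqrt v * x)))"
    unfolding char_def by (subst integral_distr) auto
  also have "\<dots> = char std_normal_distribution (s * sqrt v)"
    by (simp add: char_def mult.assoc)
  also have "\<dots> = complex_of_real (exp (- (s\<^sup>2 * v) / 2))"
    using assms by (simp add: char_std_normal_distribution power_mult_distrib)
  finally show ?thesis .
qed

lemma char_iid_normal_sum:
  assumes J: "finite J"
  shows "(CLINT x|PiM J (\<lambda>_. std_normal_distribution). iexp (s * (\<Sum>j\<in>J. u j * x j)))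
    = complex_of_real (exp (- (s\<^sup>2 * (\<Sum>j\<in>J. (u j)\<^sup>2)) / 2))"
proof -
  interpret product_prob_space "\<lambda>_. std_normal_distribution" J
    by (simp add: product_prob_space_def product_prob_space_axioms_def product_sigma_finite_def
        prob_space_imp_sigma_finite)
  have "(CLINT x|PiM J (\<lambda>_. std_normal_distribution). iexp (s * (\<Sum>j\<in>J. u j * x j)))
     = (CLINT x|PiM J (\<lambda>_. std_normal_distribution). (\<Prod>j\<in>J. iexp ((s * u j) * x j)))"
    using J by (simp add: exp_sum[symmetric] sum_distrib_left mult_ac)
  also have "\<dots> = (\<Prod>j\<in>J. CLINT x|std_normal_distribution. iexp ((s * u j) * x))"
  proof (rule product_integral_prod[OF J])
    fix j
    show "integrable std_normal_distribution (\<lambda>x. iexp (s * u j * x))"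
      by (rule prob_space.integrable_iexp[OF prob_space_std_normal]) auto
  qed
  also have "\<dots> = (\<Prod>j\<in>J. complex_of_real (exp (- (s * u j)\<^sup>2 / 2)))"
    by (subst char_std_normal_distribution[THEN fun_cong, symmetric]) (simp add: char_def)
  also have "\<dots> = complex_of_real (exp (\<Sum>j\<in>J. - (s * u j)\<^sup>2 / 2))"
    using J by (simp add: exp_sum)
  also have "(\<Sum>j\<in>J. - (s * u j)\<^sup>2 / 2) = - (s\<^sup>2 * (\<Sum>j\<in>J. (u j)\<^sup>2)) / 2"
    by (simp add: power_mult_distrib sum_distrib_left sum_negf sum_divide_distrib)
  finally show ?thesis .
qed

text \<open>If \<open>g\<close> is a family of i.i.d. normals indexed by pairs \<open>(p, q)\<close>, then the field \<open>\<Sum>(p, q). pair_coeff d (p, q) i * g (p, q)\<close>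
  has covariance \<open>d i j\<close> for \<open>i \<noteq> j\<close> and variance \<open>\<Sum>j. \<bar>d i j\<bar>\<close> at \<open>i\<close>, for symmetric \<open>d\<close> with zero diagonal. An independent
  free field makes up for the missing variance.\<close>

definition pair_coeff :: "(nat \<Rightarrow> nat \<Rightarrow> real) \<Rightarrow> nat \<times> nat \<Rightarrow> nat \<Rightarrow> real" where
  "pair_coeff d = (\<lambda>(p, q) i. sqrt (\<bar>d p q\<bar> / 2) * (of_bool (i = p) + sgn (d p q) * of_bool (i = q)))"

lemma pair_coeff_sum:
  assumes "p < n" "q < n"
  shows "(\<Sum>i<n. t i * pair_coeff d (p, q) i) = sqrt (\<bar>d p q\<bar> / 2) * (t p + sgn (d p q) * t q)"
proof -
  let ?c = "sqrt (\<bar>d p q\<bar> / 2)"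
  have "t i * pair_coeff d (p, q) i = (if i = p then ?c * t p else 0) + (if i = q then ?c * (sgn (d p q) * t q) else 0)" for i
    by (simp add: pair_coeff_def algebra_simps)
  then have "(\<Sum>i<n. t i * pair_coeff d (p, q) i)
    = (\<Sum>i<n. if i = p then ?c * t p else 0) + (\<Sum>i<n. if i = q then ?c * (sgn (d p q) * t q) else 0)"
    by (simp only: sum.distrib)
  then show ?thesis using assms by (simp add: distrib_left)
qed

text \<open>An ordered pair \<open>(p, q)\<close> contributes exactly the off-diagonal term
  \<open>t p * t q * d p q\<close>, plus half of \<open>\<bar>d p q\<bar>\<close> to the variance at
  \<open>p\<close> and half at \<open>q\<close>. The resulting excess at \<open>i\<close> is the row
  sum of \<open>\<bar>d\<bar>\<close>, which is what the square root takes away from the free field;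
  \<open>small\<close> keeps its argument nonnegative.\<close>

lemma pair_coeff_variance:
  fixes C :: "nat \<Rightarrow> nat \<Rightarrow> real" and t :: "nat \<Rightarrow> real"
  assumes C: "\<And>i. C i i = 1" "\<And>i j. C i j = C j i"
    and d: "d = (\<lambda>i j. if i = j then 0 else C i j)"
    and small: "\<And>i. i < n \<Longrightarrow> (\<Sum>j<n. \<bar>d i j\<bar>) \<le> 1"
  shows "(\<Sum>i<n. (t i * sqrt (1 - (\<Sum>j<n. \<bar>d i j\<bar>)))\<^sup>2)
      + (\<Sum>x\<in>{..<n} \<times> {..<n}. (\<Sum>i<n. t i * pair_coeff d x i)\<^sup>2)
    = (\<Sum>i<n. \<Sum>j<n. t i * t j * C i j)"
proof -
  have dsym: "d p q = d q p" for p q using C(2) by (simp add: d)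
  \<comment> \<open>The factor 1/2 under the root is chosen so that the cross term of the square is
    \<open>a * b * e\<close> without a constant; \<open>sgn e\<close> restores the sign that the
    root loses.\<close>
  have sq: "(sqrt (\<bar>e\<bar> / 2) * (a + sgn e * b))\<^sup>2 = \<bar>e\<bar> * a\<^sup>2 / 2 + \<bar>e\<bar> * b\<^sup>2 / 2 + a * b * e" for e a b :: real
  proof -
    have "(sqrt (\<bar>e\<bar> / 2) * (a + sgn e * b))\<^sup>2 = \<bar>e\<bar> / 2 * (a + sgn e * b)\<^sup>2"
      by (simp add: power_mult_distrib)
    also have "\<dots> = \<bar>e\<bar> * a\<^sup>2 / 2 + \<bar>e\<bar> * b\<^sup>2 / 2 + a * b * e"
      by (cases e "0::real" rule: linorder_cases) (simp_all add: power2_eq_square field_simps)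
    finally show ?thesis .
  qed
  have "(\<Sum>x\<in>{..<n} \<times> {..<n}. (\<Sum>i<n. t i * pair_coeff d x i)\<^sup>2)
    = (\<Sum>p<n. \<Sum>q<n. (\<Sum>i<n. t i * pair_coeff d (p, q) i)\<^sup>2)"
    by (simp add: sum.cartesian_product split_beta)
  also have "\<dots> = (\<Sum>p<n. \<Sum>q<n. \<bar>d p q\<bar> * (t p)\<^sup>2 / 2 + \<bar>d p q\<bar> * (t q)\<^sup>2 / 2 + t p * t q * d p q)"
    by (intro sum.cong refl) (simp add: pair_coeff_sum sq)
  also have "\<dots> = (\<Sum>p<n. \<Sum>q<n. \<bar>d p q\<bar> * (t p)\<^sup>2 / 2) + (\<Sum>p<n. \<Sum>q<n. \<bar>d p q\<bar> * (t q)\<^sup>2 / 2)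
      + (\<Sum>p<n. \<Sum>q<n. t p * t q * d p q)"
    by (simp only: sum.distrib)
  \<comment> \<open>By symmetry of \<open>d\<close> the two half contributions coincide and add up
    to full row sums.\<close>
  also have "(\<Sum>p<n. \<Sum>q<n. \<bar>d p q\<bar> * (t q)\<^sup>2 / 2) = (\<Sum>p<n. \<Sum>q<n. \<bar>d p q\<bar> * (t p)\<^sup>2 / 2)"
    by (subst sum.swap) (intro sum.cong refl, simp add: dsym)
  finally have off: "(\<Sum>x\<in>{..<n} \<times> {..<n}. (\<Sum>i<n. t i * pair_coeff d x i)\<^sup>2)
     = (\<Sum>p<n. (t p)\<^sup>2 * (\<Sum>q<n. \<bar>d p q\<bar>)) + (\<Sum>p<n. \<Sum>q<n. t p * t q * d p q)"
    by (simp add: sum_divide_distrib[symmetric] sum_distrib_left mult.commute)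
  have "(\<Sum>i<n. (t i * sqrt (1 - (\<Sum>j<n. \<bar>d i j\<bar>)))\<^sup>2) = (\<Sum>i<n. (t i)\<^sup>2 - (t i)\<^sup>2 * (\<Sum>j<n. \<bar>d i j\<bar>))"
    using small by (intro sum.cong refl) (simp add: power_mult_distrib right_diff_distrib)
  moreover have "(\<Sum>i<n. \<Sum>j<n. t i * t j * C i j) = (\<Sum>i<n. (t i)\<^sup>2) + (\<Sum>i<n. \<Sum>j<n. t i * t j * d i j)"
  proof -
    have "t i * t j * C i j = (if j = i then (t i)\<^sup>2 else 0) + t i * t j * d i j" for i j
      using C(1) by (simp add: d power2_eq_square)
    then have "(\<Sum>i<n. \<Sum>j<n. t i * t j * C i j)
       = (\<Sum>i<n. (\<Sum>j<n. if j = i then (t i)\<^sup>2 else 0)) + (\<Sum>i<n. \<Sum>j<n. t i * t j * d i j)"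
      by (simp only: sum.distrib)
    then show ?thesis by simp
  qed
  ultimately show ?thesis unfolding off by (simp add: sum_subtractf)
qed

text \<open>The explicit field has the right variance for each combination of the first
  \<open>n\<close> coordinates, so characteristic functions and \<open>cylinder_integral_eq\<close>
  identify it with \<open>L\<close>. The perturbation \<open>g\<close> is integrated last: for fixed
  \<open>g\<close> the inner field is an affine image of i.i.d. normals and has a density when the
  scale factors are positive.\<close>

lemma gaussian_mixture:
  fixes C :: "nat \<Rightarrow> nat \<Rightarrow> real" and L :: "(nat \<Rightarrow> real) measure" and H :: "(nat \<Rightarrow> real) \<Rightarrow> real"
  assumes C: "\<And>i. C i i = 1" "\<And>i j. C i j = C j i"
    and d: "d = (\<lambda>i j. if i = j then 0 else C i j)"
    and small: "\<And>i. i < n \<Longrightarrow> (\<Sum>j<n. \<bar>d i j\<bar>) \<le> 1"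
    and L: "prob_space L" "centered_gaussian_field C L"
    and H [measurable]: "H \<in> borel_measurable field_space"
    and cyl: "\<And>x y. (\<And>i. i < n \<Longrightarrow> x i = y i) \<Longrightarrow> H x = H y"
    and B: "\<And>x. \<bar>H x\<bar> \<le> B"
  shows "(\<integral>x. H x \<partial>L) = (\<integral>g. (\<integral>z. H (\<lambda>i. if i < n then
      (\<Sum>x\<in>{..<n} \<times> {..<n}. pair_coeff d x i * g x) + sqrt (1 - (\<Sum>j<n. \<bar>d i j\<bar>)) * z i else 0)
      \<partial>PiM {..<n} (\<lambda>_. std_normal_distribution)) \<partial>PiM ({..<n} \<times> {..<n}) (\<lambda>_. std_normal_distribution))"
proof -
  let ?P = "{..<n} \<times> {..<n}"
  let ?Z = "PiM {..<n} (\<lambda>_. std_normal_distribution)" and ?G = "PiM ?P (\<lambda>_. std_normal_distribution)"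
  define a where "a i = sqrt (1 - (\<Sum>j<n. \<bar>d i j\<bar>))" for i
  define off where "off g i = (\<Sum>x\<in>?P. pair_coeff d x i * g x)" for g i
  define \<kappa> where "\<kappa> z g i = (if i < n then off g i + a i * z i else 0)" for z g i
  interpret Z: prob_space ?Z by (rule prob_space_PiM) simp
  interpret G: prob_space ?G by (rule prob_space_PiM) simp
  interpret ZG: pair_prob_space ?Z ?G ..
  have off [measurable]: "(\<lambda>g. off g i) \<in> borel_measurable ?G" for i unfolding off_def by measurable
  have \<kappa> [measurable]: "(\<lambda>(z, g). \<kappa> z g) \<in> ?Z \<Otimes>\<^sub>M ?G \<rightarrow>\<^sub>M field_space"
  proof (rule measurable_PiM_single')
    fix i
    show "(\<lambda>x. (case x of (z, g) \<Rightarrow> \<kappa> z g) i) \<in> borel_measurable (?Z \<Otimes>\<^sub>M ?G)"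
      unfolding \<kappa>_def split_beta by (cases "i < n") auto
  qed (auto simp: space_PiM)
  define N where "N = distr (?Z \<Otimes>\<^sub>M ?G) field_space (\<lambda>(z, g). \<kappa> z g)"
  have N: "prob_space N" unfolding N_def by (rule ZG.prob_space_distr) measurable
  have sN [measurable_cong]: "sets N = sets field_space" by (simp add: N_def)
  have sL [measurable_cong]: "sets L = sets field_space" using L by (simp add: centered_gaussian_field_def)
  have "(\<integral>x. H x \<partial>L) = (\<integral>x. H x \<partial>N)"
  proof (rule cylinder_integral_eq[OF L(1) N sL sN _ H cyl])
    fix t :: "nat \<Rightarrow> real"
    let ?v = "\<Sum>i<n. \<Sum>j<n. t i * t j * C i j"
    let ?\<theta> = "\<lambda>x::nat \<Rightarrow> real. \<Sum>i<n. t i * x i"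
    have LD: "distr L borel ?\<theta> = centered_normal ?v"
      using L(2) by (simp add: centered_gaussian_field_def)
    have var: "(\<Sum>i<n. (t i * a i)\<^sup>2) + (\<Sum>x\<in>?P. (\<Sum>i<n. t i * pair_coeff d x i)\<^sup>2) = ?v"
      unfolding a_def by (rule pair_coeff_variance[OF C d small])
    \<comment> \<open>Nonnegativity is read off from the representation as a sum of squares.\<close>
    have v: "?v \<ge> 0" by (subst var[symmetric]) (auto intro!: add_nonneg_nonneg sum_nonneg)
    have "char (distr N borel ?\<theta>) s = char (centered_normal ?v) s" for s
    proof -
      let ?u = "\<lambda>i. t i * a i" and ?w = "\<lambda>x. \<Sum>i<n. t i * pair_coeff d x i"
      have \<theta>: "?\<theta> (\<kappa> z g) = (\<Sum>i<n. ?u i * z i) + (\<Sum>x\<in>?P. ?w x * g x)" for z g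
      proof -
        have "?\<theta> (\<kappa> z g) = (\<Sum>i<n. ?u i * z i) + (\<Sum>i<n. \<Sum>x\<in>?P. t i * pair_coeff d x i * g x)"
          by (simp add: \<kappa>_def off_def sum.distrib[symmetric] sum_distrib_left algebra_simps)
        also have "(\<Sum>i<n. \<Sum>x\<in>?P. t i * pair_coeff d x i * g x) = (\<Sum>x\<in>?P. ?w x * g x)"
          by (subst sum.swap) (simp add: sum_distrib_right)
        finally show ?thesis .
      qed
      have "char (distr N borel ?\<theta>) s = (CLINT x|?Z \<Otimes>\<^sub>M ?G. iexp (s * ?\<theta> (case x of (z, g) \<Rightarrow> \<kappa> z g)))"
        unfolding char_def N_def by (simp add: distr_distr integral_distr comp_def)
      also have "\<dots> = (CLINT z|?Z. CLINT g|?G. iexp (s * ?\<theta> (\<kappa> z g)))"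
        by (subst ZG.integral_fst'[symmetric]) (auto intro!: ZG.P.integrable_const_bound[of _ 1])
      also have "\<dots> = (CLINT z|?Z. CLINT g|?G. iexp (s * (\<Sum>i<n. ?u i * z i)) * iexp (s * (\<Sum>x\<in>?P. ?w x * g x)))"
        by (simp add: \<theta> exp_add[symmetric] distrib_left)
      also have "\<dots> = complex_of_real (exp (- (s\<^sup>2 * (\<Sum>i<n. (?u i)\<^sup>2)) / 2))
          * complex_of_real (exp (- (s\<^sup>2 * (\<Sum>x\<in>?P. (?w x)\<^sup>2)) / 2))"
        by (simp only: integral_mult_right_zero integral_mult_left_zero char_iid_normal_sum
            finite_lessThan finite_cartesian_product)
      also have "\<dots> = complex_of_real (exp (- (s\<^sup>2 * ?v) / 2))"
        unfolding var[symmetric]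
        by (simp add: of_real_mult[symmetric] exp_add[symmetric] field_simps del: of_real_exp of_real_mult)
      finally show ?thesis using v by (simp add: char_centered_normal)
    qed
    then show "distr L borel ?\<theta> = distr N borel ?\<theta>"
      unfolding LD using v
      by (intro Levy_uniqueness real_distribution_centered_normal prob_space.real_distribution_distr[OF N] ext) auto
  qed
  also have "\<dots> = (\<integral>x. H (case x of (z, g) \<Rightarrow> \<kappa> z g) \<partial>(?Z \<Otimes>\<^sub>M ?G))"
    unfolding N_def by (subst integral_distr) auto
  also have "\<dots> = (\<integral>g. \<integral>z. H (\<kappa> z g) \<partial>?Z \<partial>?G)"
    by (subst ZG.integral_snd) (auto intro!: ZG.P.integrable_const_bound[of _ B] simp: B case_prod_unfold)
  finally show ?thesis unfolding \<kappa>_def off_def a_def .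
qed

section \<open>Total variation convergence of affine images of i.i.d. normals\<close>

lemma affine_normal_law:
  fixes n :: nat
  assumes \<sigma>: "\<And>i. i < n \<Longrightarrow> \<sigma> i > 0"
  shows "distr (PiM {..<n} (\<lambda>_. std_normal_distribution)) (PiM {..<n} (\<lambda>_. borel)) (\<lambda>z. \<lambda>i\<in>{..<n}. \<beta> i + \<sigma> i * z i)
    = density (PiM {..<n} (\<lambda>_. lborel)) (\<lambda>x. ennreal (\<Prod>i<n. normal_density (\<beta> i) (\<sigma> i) (x i)))"
    (is "distr ?Z ?B ?f = density ?L ?g")
proof -
  interpret Z: product_prob_space "\<lambda>_. std_normal_distribution" "{..<n}"
    by (simp add: product_prob_space_def product_prob_space_axioms_def product_sigma_finite_def
        prob_space_imp_sigma_finite)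
  interpret L: product_sigma_finite "\<lambda>_. lborel :: real measure"
    by (simp add: product_sigma_finite_def sigma_finite_lborel)
  have [measurable]: "?f \<in> ?Z \<rightarrow>\<^sub>M ?B" by measurable
  have sL: "sets ?L = sets ?B" by (intro sets_PiM_cong) auto
  have Z1: "prob_space ?Z" by (rule prob_space_PiM) simp
  show ?thesis
  proof (rule measure_eqI_PiM_finite)
    fix A :: "nat \<Rightarrow> real set" assume A: "\<And>i. i \<in> {..<n} \<Longrightarrow> A i \<in> sets borel"
    have pre: "(\<lambda>x. \<beta> i + \<sigma> i * x) -` A i \<in> sets borel" if "i < n" for i
      using measurable_sets[of "\<lambda>x. \<beta> i + \<sigma> i * x" borel borel "A i"] A that by simp
    have one: "emeasure std_normal_distribution ((\<lambda>x. \<beta> i + \<sigma> i * x) -` A i)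
      = (\<integral>\<^sup>+x. ennreal (normal_density (\<beta> i) (\<sigma> i) x) * indicator (A i) x \<partial>lborel)" if "i < n" for i
    proof -
      have "emeasure std_normal_distribution ((\<lambda>x. \<beta> i + \<sigma> i * x) -` A i)
        = emeasure (distr std_normal_distribution lborel (\<lambda>x. \<beta> i + \<sigma> i * x)) (A i)"
        using A that by (subst emeasure_distr) auto
      also have "\<dots> = emeasure (density lborel (normal_density (\<beta> i) (\<sigma> i))) (A i)"
        using \<sigma>[OF that] by (simp only: distr_std_normal_affine)
      finally show ?thesis using A that by (simp add: emeasure_density)
    qed
    have "emeasure (distr ?Z ?B ?f) (PiE {..<n} A) = emeasure ?Z (?f -` PiE {..<n} A \<inter> space ?Z)"
      using A by (intro emeasure_distr) (auto intro!: sets_PiM_I_finite)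
    also have "?f -` PiE {..<n} A \<inter> space ?Z = PiE {..<n} (\<lambda>i. (\<lambda>x. \<beta> i + \<sigma> i * x) -` A i)"
      by (auto simp: space_PiM PiE_iff)
    also have "emeasure ?Z \<dots> = (\<Prod>i<n. emeasure std_normal_distribution ((\<lambda>x. \<beta> i + \<sigma> i * x) -` A i))"
      using pre by (subst Z.emeasure_PiM) auto
    also have "\<dots> = (\<Prod>i<n. \<integral>\<^sup>+x. ennreal (normal_density (\<beta> i) (\<sigma> i) x) * indicator (A i) x \<partial>lborel)"
      by (intro prod.cong refl) (simp add: one)
    also have "\<dots> = (\<integral>\<^sup>+x. (\<Prod>i<n. ennreal (normal_density (\<beta> i) (\<sigma> i) (x i)) * indicator (A i) (x i)) \<partial>?L)"
      using A by (subst L.product_nn_integral_prod) auto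
    also have "\<dots> = (\<integral>\<^sup>+x. ?g x * indicator (PiE {..<n} A) x \<partial>?L)"
    proof (rule nn_integral_cong)
      fix x assume "x \<in> space ?L"
      then have "(\<Prod>i<n. indicator (A i) (x i)) = (indicator (PiE {..<n} A) x :: ennreal)"
        by (auto simp: indicator_def space_PiM PiE_iff prod_zero_iff)
      then show "(\<Prod>i<n. ennreal (normal_density (\<beta> i) (\<sigma> i) (x i)) * indicator (A i) (x i))
        = ?g x * indicator (PiE {..<n} A) x"
        by (simp add: prod.distrib prod_ennreal)
    qed
    also have "\<dots> = emeasure (density ?L ?g) (PiE {..<n} A)"
      using A by (subst emeasure_density) (auto intro!: sets_PiM_I_finite)
    finally show "emeasure (distr ?Z ?B ?f) (PiE {..<n} A) = emeasure (density ?L ?g) (PiE {..<n} A)" .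
  next
    show "range (\<lambda>_::nat. space ?B) \<subseteq> prod_algebra {..<n} (\<lambda>_. borel)"
      by (auto simp: space_PiM intro!: prod_algebraI_finite)
    show "emeasure (distr ?Z ?B ?f) (space ?B) \<noteq> \<infinity>"
      using prob_space.emeasure_space_1[OF prob_space.prob_space_distr[OF Z1, of ?f ?B]] by simp
  qed (use sL in auto)
qed

text \<open>A change of variables moves the parameters out of the argument of \<open>H\<close>,
  which is only measurable, into the density. There they converge pointwise, hence in the mean by
  Scheffe's lemma, and \<open>H\<close> is bounded.\<close>

lemma affine_normal_tendsto:
  fixes H :: "(nat \<Rightarrow> real) \<Rightarrow> real"
  assumes \<sigma>: "\<And>k i. i < n \<Longrightarrow> \<sigma> k i > 0"
    and \<sigma>1: "\<And>i. i < n \<Longrightarrow> (\<lambda>k. \<sigma> k i) \<longlonglongrightarrow> 1" and \<beta>0: "\<And>i. i < n \<Longrightarrow> (\<lambda>k. \<beta> k i) \<longlonglongrightarrow> 0"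
    and H [measurable]: "H \<in> borel_measurable field_space" and B: "\<And>x. \<bar>H x\<bar> \<le> B"
  shows "(\<lambda>k. \<integral>z. H (\<lambda>i. if i < n then \<beta> k i + \<sigma> k i * z i else 0) \<partial>PiM {..<n} (\<lambda>_. std_normal_distribution))
    \<longlonglongrightarrow> (\<integral>z. H (\<lambda>i. if i < n then z i else 0) \<partial>PiM {..<n} (\<lambda>_. std_normal_distribution))"
proof -
  let ?Z = "PiM {..<n} (\<lambda>_. std_normal_distribution)" and ?B = "PiM {..<n} (\<lambda>_. borel :: real measure)"
  let ?L = "PiM {..<n} (\<lambda>_. lborel :: real measure)"
  define H' where "H' y = H (\<lambda>i. if i < n then y i else 0)" for y
  have ext: "(\<lambda>y i. if i < n then y i else 0) \<in> ?B \<rightarrow>\<^sub>M field_space"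
  proof (rule measurable_PiM_single')
    fix i :: nat
    show "(\<lambda>y. if i < n then y i else 0) \<in> borel_measurable ?B"
      by (cases "i < n") auto
  qed (auto simp: space_PiM)
  have H' [measurable]: "H' \<in> borel_measurable ?B"
    unfolding H'_def using measurable_compose[OF ext H] .
  have sL [measurable_cong]: "sets ?L = sets ?B" by (intro sets_PiM_cong) auto
  have Z1: "prob_space ?Z" by (rule prob_space_PiM) simp
  define f where "f \<beta> \<sigma> x = (\<Prod>i<n. normal_density (\<beta> i) (\<sigma> i) (x i))" for \<beta> \<sigma> x
  have [measurable]: "f \<beta> \<sigma> \<in> borel_measurable ?L" for \<beta> \<sigma> unfolding f_def by measurable
  have f0: "0 \<le> f \<beta> \<sigma> x" for \<beta> \<sigma> x unfolding f_def by (intro prod_nonneg) auto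
  have eq: "(\<integral>z. H (\<lambda>i. if i < n then \<beta> i + \<sigma> i * z i else 0) \<partial>?Z) = (\<integral>x. f \<beta> \<sigma> x * H' x \<partial>?L)"
    and int: "(\<integral>\<^sup>+x. f \<beta> \<sigma> x \<partial>?L) = 1"
    if s: "\<And>i. i < n \<Longrightarrow> \<sigma> i > 0" for \<beta> \<sigma>
  proof -
    let ?f = "\<lambda>z. \<lambda>i\<in>{..<n}. \<beta> i + \<sigma> i * z i"
    have [measurable]: "?f \<in> ?Z \<rightarrow>\<^sub>M ?B" by measurable
    have "(\<integral>z. H (\<lambda>i. if i < n then \<beta> i + \<sigma> i * z i else 0) \<partial>?Z) = (\<integral>z. H' (?f z) \<partial>?Z)"
      by (simp add: H'_def cong: if_cong)
    also have "\<dots> = (\<integral>x. H' x \<partial>distr ?Z ?B ?f)" by (subst integral_distr) auto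
    also have "\<dots> = (\<integral>x. f \<beta> \<sigma> x * H' x \<partial>?L)"
      using f0 by (simp add: affine_normal_law[OF s] integral_density f_def[symmetric])
    finally show "(\<integral>z. H (\<lambda>i. if i < n then \<beta> i + \<sigma> i * z i else 0) \<partial>?Z) = (\<integral>x. f \<beta> \<sigma> x * H' x \<partial>?L)" .
    have "emeasure (distr ?Z ?B ?f) (space ?B) = 1"
      using prob_space.emeasure_space_1[OF prob_space.prob_space_distr[OF Z1, of ?f ?B]] by simp
    moreover have "space ?B = space ?L" using sets_eq_imp_space_eq[OF sL] by simp
    ultimately show "(\<integral>\<^sup>+x. f \<beta> \<sigma> x \<partial>?L) = 1"
      by (simp add: affine_normal_law[OF s] f_def[symmetric] emeasure_density cong: nn_integral_cong)
  qed
  have nd: "(\<lambda>k. normal_density (\<beta> k i) (\<sigma> k i) x) \<longlonglongrightarrow> normal_density 0 1 x" if "i < n" for i x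
    unfolding normal_density_def
    by (rule tendsto_eq_intros \<sigma>1[OF that] \<beta>0[OF that] refl | simp)+
  let ?f1 = "f (\<lambda>_. 0) (\<lambda>_. 1)"
  have i1: "integrable ?L ?f1"
    using int[of "\<lambda>_. 1" "\<lambda>_. 0"] f0 by (auto simp: integrable_iff_bounded)
  have ik: "integrable ?L (f (\<beta> k) (\<sigma> k))" for k
    using int[of "\<sigma> k" "\<beta> k"] f0 \<sigma> by (auto simp: integrable_iff_bounded)
  have "(\<lambda>k. \<integral>\<^sup>+x. norm (f (\<beta> k) (\<sigma> k) x - ?f1 x) \<partial>?L) \<longlonglongrightarrow> 0"
  proof (rule Scheffe_lemma2[OF _ i1])
    show "AE x in ?L. (\<lambda>k. f (\<beta> k) (\<sigma> k) x) \<longlonglongrightarrow> ?f1 x"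
      unfolding f_def by (intro AE_I2 tendsto_prod nd) auto
    show "(\<integral>\<^sup>+x. norm (f (\<beta> k) (\<sigma> k) x) \<partial>?L) \<le> (\<integral>\<^sup>+x. norm (?f1 x) \<partial>?L)" for k
      using int[of "\<sigma> k" "\<beta> k"] int[of "\<lambda>_. 1" "\<lambda>_. 0"] f0 \<sigma> by simp
  qed auto
  moreover have "(\<integral>\<^sup>+x. norm (f (\<beta> k) (\<sigma> k) x - ?f1 x) \<partial>?L) = ennreal (\<integral>x. norm (f (\<beta> k) (\<sigma> k) x - ?f1 x) \<partial>?L)" for k
    using i1 ik by (intro nn_integral_eq_integral) auto
  ultimately have "(\<lambda>k. ennreal (\<integral>x. norm (f (\<beta> k) (\<sigma> k) x - ?f1 x) \<partial>?L)) \<longlonglongrightarrow> ennreal 0" by simp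
  then have lim: "(\<lambda>k. B * (\<integral>x. norm (f (\<beta> k) (\<sigma> k) x - ?f1 x) \<partial>?L)) \<longlonglongrightarrow> B * 0"
    by (intro tendsto_mult tendsto_const) (subst (asm) tendsto_ennreal_iff, auto)
  have "(\<lambda>k. (\<integral>x. f (\<beta> k) (\<sigma> k) x * H' x \<partial>?L) - (\<integral>x. ?f1 x * H' x \<partial>?L)) \<longlonglongrightarrow> 0"
  proof (rule Lim_null_comparison)
    have ih: "integrable ?L (\<lambda>x. g x * H' x)" if "integrable ?L g" for g
    proof (rule Bochner_Integration.integrable_bound[of _ "\<lambda>x. B * g x"])
      show "AE x in ?L. norm (g x * H' x) \<le> norm (B * g x)"
      proof (intro AE_I2)
        fix x
        have "\<bar>g x\<bar> * \<bar>H' x\<bar> \<le> \<bar>g x\<bar> * \<bar>B\<bar>"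
          using B[of "\<lambda>i. if i < n then x i else 0"] by (intro mult_left_mono) (auto simp: H'_def)
        then show "norm (g x * H' x) \<le> norm (B * g x)" by (simp add: abs_mult mult.commute)
      qed
    qed (use that in auto)
    show "\<forall>\<^sub>F k in sequentially. norm ((\<integral>x. f (\<beta> k) (\<sigma> k) x * H' x \<partial>?L) - (\<integral>x. ?f1 x * H' x \<partial>?L))
       \<le> B * (\<integral>x. norm (f (\<beta> k) (\<sigma> k) x - ?f1 x) \<partial>?L)"
    proof (intro always_eventually allI)
      fix k
      have "(\<integral>x. f (\<beta> k) (\<sigma> k) x * H' x \<partial>?L) - (\<integral>x. ?f1 x * H' x \<partial>?L)
        = (\<integral>x. (f (\<beta> k) (\<sigma> k) x - ?f1 x) * H' x \<partial>?L)"
        by (simp add: left_diff_distrib Bochner_Integration.integral_diff[OF ih[OF ik] ih[OF i1]])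
      also have "norm \<dots> \<le> (\<integral>x. norm ((f (\<beta> k) (\<sigma> k) x - ?f1 x) * H' x) \<partial>?L)"
        by (rule integral_norm_bound)
      also have "\<dots> \<le> (\<integral>x. B * norm (f (\<beta> k) (\<sigma> k) x - ?f1 x) \<partial>?L)"
      proof (intro integral_mono integrable_norm integrable_mult_right ih)
        fix x
        show "norm ((f (\<beta> k) (\<sigma> k) x - ?f1 x) * H' x) \<le> B * norm (f (\<beta> k) (\<sigma> k) x - ?f1 x)"
          using B[of "\<lambda>i. if i < n then x i else 0"] mult_right_mono[of "\<bar>H' x\<bar>" B "\<bar>f (\<beta> k) (\<sigma> k) x - ?f1 x\<bar>"]
          by (simp add: H'_def abs_mult mult.commute)
      qed (use ik i1 in auto)
      finally show "norm ((\<integral>x. f (\<beta> k) (\<sigma> k) x * H' x \<partial>?L) - (\<integral>x. ?f1 x * H' x \<partial>?L))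
       \<le> B * (\<integral>x. norm (f (\<beta> k) (\<sigma> k) x - ?f1 x) \<partial>?L)" by simp
    qed
    show "(\<lambda>k. B * (\<integral>x. norm (f (\<beta> k) (\<sigma> k) x - ?f1 x) \<partial>?L)) \<longlonglongrightarrow> 0" using lim by simp
  qed
  then have "(\<lambda>k. \<integral>x. f (\<beta> k) (\<sigma> k) x * H' x \<partial>?L) \<longlonglongrightarrow> (\<integral>x. ?f1 x * H' x \<partial>?L)"
    by (rule LIM_zero_cancel)
  moreover have "(\<integral>z. H (\<lambda>i. if i < n then z i else 0) \<partial>?Z) = (\<integral>x. ?f1 x * H' x \<partial>?L)"
    using eq[of "\<lambda>_. 1" "\<lambda>_. 0"] by (simp cong: if_cong)
  ultimately show ?thesis using eq[OF \<sigma>] by simp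
qed

lemma free_field_cylinder_integral:
  fixes H :: "(nat \<Rightarrow> real) \<Rightarrow> real"
  assumes H [measurable]: "H \<in> borel_measurable field_space"
    and cyl: "\<And>x y. (\<And>i. i < n \<Longrightarrow> x i = y i) \<Longrightarrow> H x = H y"
  shows "(\<integral>x. H x \<partial>free_field) = (\<integral>z. H (\<lambda>i. if i < n then z i else 0) \<partial>PiM {..<n} (\<lambda>_. std_normal_distribution))"
proof -
  interpret product_prob_space "\<lambda>_. std_normal_distribution" "UNIV :: nat set"
    by (simp add: product_prob_space_def product_prob_space_axioms_def product_sigma_finite_def
        prob_space_imp_sigma_finite)
  let ?Z = "PiM {..<n} (\<lambda>_. std_normal_distribution)"
  have [measurable_cong]: "sets free_field = sets field_space"
    unfolding free_field_def by (intro sets_PiM_cong) auto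
  have ext: "(\<lambda>y i. if i < n then y i else 0) \<in> ?Z \<rightarrow>\<^sub>M field_space"
  proof (rule measurable_PiM_single')
    fix i :: nat
    show "(\<lambda>y. if i < n then y i else 0) \<in> borel_measurable ?Z"
      by (cases "i < n") auto
  qed (auto simp: space_PiM)
  have HZ: "(\<lambda>z. H (\<lambda>i. if i < n then z i else 0)) \<in> borel_measurable ?Z"
    using measurable_compose[OF ext H] .
  have Z: "?Z = distr free_field ?Z (\<lambda>x. restrict x {..<n})"
    unfolding free_field_def by (rule distr_PiM_restrict_finite[symmetric]) auto
  have "(\<integral>z. H (\<lambda>i. if i < n then z i else 0) \<partial>?Z)
     = (\<integral>x. H (\<lambda>i. if i < n then restrict x {..<n} i else 0) \<partial>free_field)"
    by (subst Z, subst integral_distr) (use HZ in \<open>auto simp: free_field_def\<close>)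
  also have "\<dots> = (\<integral>x. H x \<partial>free_field)"
    by (intro Bochner_Integration.integral_cong refl cyl) auto
  finally show ?thesis ..
qed

text \<open>The normals \<open>g\<close> and \<open>z\<close> of the mixture are the same for all
  \<open>k\<close>; only the coefficients move. For each \<open>g\<close> the shift tends to 0 and
  the scale to 1, and the limit passes through the integral over \<open>g\<close> by
  domination.\<close>

lemma gaussian_cylinder_tendsto:
  fixes C :: "nat \<Rightarrow> nat \<Rightarrow> nat \<Rightarrow> real" and L :: "nat \<Rightarrow> (nat \<Rightarrow> real) measure" and H :: "(nat \<Rightarrow> real) \<Rightarrow> real"
  assumes C: "\<And>k i. C k i i = 1" "\<And>k i j. C k i j = C k j i"
    and lim: "\<And>i j. i \<noteq> j \<Longrightarrow> (\<lambda>k. C k i j) \<longlonglongrightarrow> 0"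
    and L: "\<And>k. prob_space (L k)" "\<And>k. centered_gaussian_field (C k) (L k)"
    and H [measurable]: "H \<in> borel_measurable field_space"
    and cyl: "\<And>x y. (\<And>i. i < n \<Longrightarrow> x i = y i) \<Longrightarrow> H x = H y"
    and B: "\<And>x. \<bar>H x\<bar> \<le> B"
  shows "(\<lambda>k. \<integral>x. H x \<partial>L k) \<longlonglongrightarrow> (\<integral>x. H x \<partial>free_field)"
proof -
  let ?P = "{..<n} \<times> {..<n}"
  let ?Z = "PiM {..<n} (\<lambda>_. std_normal_distribution)" and ?G = "PiM ?P (\<lambda>_. std_normal_distribution)"
  define d where "d k i j = (if i = j then 0 else C k i j)" for k i j
  have d0: "(\<lambda>k. d k i j) \<longlonglongrightarrow> 0" for i j
    using lim by (cases "i = j") (auto simp: d_def)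
  have s0: "(\<lambda>k. \<Sum>j<n. \<bar>d k i j\<bar>) \<longlonglongrightarrow> 0" for i
    by (rule tendsto_eq_intros tendsto_rabs_zero d0 refl | simp)+
  \<comment> \<open>Strict inequality is needed: it makes the scales \<open>\<sigma>\<close>
    positive, so that the inner field has a density.\<close>
  have "\<forall>\<^sub>F k in sequentially. \<forall>i\<in>{..<n}. (\<Sum>j<n. \<bar>d k i j\<bar>) < 1"
    by (intro eventually_ball_finite ballI order_tendstoD(2)[OF s0]) auto
  then obtain K where K: "\<And>k i. k \<ge> K \<Longrightarrow> i < n \<Longrightarrow> (\<Sum>j<n. \<bar>d k i j\<bar>) < 1"
    by (auto simp: eventually_sequentially)
  define \<sigma> where "\<sigma> k i = sqrt (1 - (\<Sum>j<n. \<bar>d (k + K) i j\<bar>))" for k i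
  define \<beta> where "\<beta> g k i = (\<Sum>x\<in>?P. pair_coeff (d (k + K)) x i * g x)" for g k i
  define F where "F k g = (\<integral>z. H (\<lambda>i. if i < n then \<beta> g k i + \<sigma> k i * z i else 0) \<partial>?Z)" for k g
  have mix: "(\<integral>x. H x \<partial>L (k + K)) = (\<integral>g. F k g \<partial>?G)" for k
    unfolding F_def \<sigma>_def \<beta>_def
    by (rule gaussian_mixture[OF C[of "k + K"] _ _ L H cyl B])
      (use K in \<open>auto simp: d_def[abs_def] less_imp_le\<close>)
  have \<sigma>1: "(\<lambda>k. \<sigma> k i) \<longlonglongrightarrow> 1" for i
  proof -
    have "(\<lambda>k. sqrt (1 - (\<Sum>j<n. \<bar>d k i j\<bar>))) \<longlonglongrightarrow> sqrt (1 - 0)"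
      by (intro tendsto_intros s0)
    then show ?thesis unfolding \<sigma>_def using LIMSEQ_ignore_initial_segment[of _ 1 K] by simp
  qed
  \<comment> \<open>The sign in the coefficient need not converge, so the coefficient is bounded by
    a multiple of the root instead.\<close>
  have pc: "(\<lambda>k. pair_coeff (d (k + K)) x i) \<longlonglongrightarrow> 0" for x i
  proof (rule Lim_null_comparison)
    obtain p q where x: "x = (p, q)" by (cases x)
    have "\<bar>of_bool (i = p) + sgn (d k p q) * of_bool (i = q)\<bar> \<le> (2::real)" for k
      by (auto simp: of_bool_def sgn_real_def)
    then have "\<bar>pair_coeff (d k) x i\<bar> \<le> sqrt (\<bar>d k p q\<bar> / 2) * 2" for k
      by (auto simp: pair_coeff_def x abs_mult intro!: mult_left_mono)
    then show "\<forall>\<^sub>F k in sequentially. norm (pair_coeff (d (k + K)) x i)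
        \<le> sqrt (\<bar>d (k + K) (fst x) (snd x)\<bar> / 2) * 2"
      by (auto simp: x intro!: always_eventually)
    have "(\<lambda>k. sqrt (\<bar>d k (fst x) (snd x)\<bar> / 2) * 2) \<longlonglongrightarrow> sqrt (0 / 2) * 2"
      by (intro tendsto_intros tendsto_rabs_zero d0) auto
    then show "(\<lambda>k. sqrt (\<bar>d (k + K) (fst x) (snd x)\<bar> / 2) * 2) \<longlonglongrightarrow> 0"
      using LIMSEQ_ignore_initial_segment[of "\<lambda>k. sqrt (\<bar>d k (fst x) (snd x)\<bar> / 2) * 2" 0 K] by simp
  qed
  have \<beta>0: "(\<lambda>k. \<beta> g k i) \<longlonglongrightarrow> 0" for g i
    unfolding \<beta>_def by (intro tendsto_null_sum tendsto_mult_left_zero pc)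
  have free: "(\<integral>x. H x \<partial>free_field) = (\<integral>z. H (\<lambda>i. if i < n then z i else 0) \<partial>?Z)"
    by (rule free_field_cylinder_integral[OF H cyl])
  have Flim: "(\<lambda>k. F k g) \<longlonglongrightarrow> (\<integral>x. H x \<partial>free_field)" for g
    unfolding F_def free
    by (rule affine_normal_tendsto[OF _ \<sigma>1 \<beta>0 H B]) (use K in \<open>auto simp: \<sigma>_def\<close>)
  interpret Z: prob_space ?Z by (rule prob_space_PiM) simp
  interpret G: prob_space ?G by (rule prob_space_PiM) simp
  have Fm: "F k \<in> borel_measurable ?G" for k
  proof -
    have \<beta>m [measurable]: "(\<lambda>g. \<beta> g k i) \<in> borel_measurable ?G" for i unfolding \<beta>_def by measurable
    have ext: "(\<lambda>x i. if i < n then \<beta> (fst x) k i + \<sigma> k i * snd x i else 0) \<in> ?G \<Otimes>\<^sub>M ?Z \<rightarrow>\<^sub>M field_space"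
    proof (rule measurable_PiM_single')
      fix i :: nat
      show "(\<lambda>x. if i < n then \<beta> (fst x) k i + \<sigma> k i * snd x i else 0) \<in> borel_measurable (?G \<Otimes>\<^sub>M ?Z)"
        by (cases "i < n") auto
    qed (auto simp: space_PiM)
    show ?thesis unfolding F_def
      by (rule Z.borel_measurable_lebesgue_integral)
        (use measurable_compose[OF ext H] in \<open>simp add: case_prod_unfold\<close>)
  qed
  have Fb: "norm (F k g) \<le> B" for k g
  proof -
    have B0: "0 \<le> B" using B[of undefined] by linarith
    \<comment> \<open>A non-integrable function has integral 0, so the bound holds without a
      measurability check.\<close>
    have bound: "\<bar>\<integral>z. h z \<partial>?Z\<bar> \<le> B" if "\<And>z. \<bar>h z\<bar> \<le> B" for h :: "(nat \<Rightarrow> real) \<Rightarrow> real"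
    proof (cases "integrable ?Z h")
      case True
      have "\<bar>\<integral>z. h z \<partial>?Z\<bar> \<le> (\<integral>z. \<bar>h z\<bar> \<partial>?Z)" by (rule integral_abs_bound)
      also have "\<dots> \<le> B" using True that by (intro Z.integral_le_const AE_I2) auto
      finally show ?thesis .
    qed (simp add: not_integrable_integral_eq B0)
    show ?thesis unfolding F_def real_norm_def by (rule bound) (rule B)
  qed
  have "(\<lambda>k. \<integral>g. F k g \<partial>?G) \<longlonglongrightarrow> (\<integral>g. (\<integral>x. H x \<partial>free_field) \<partial>?G)"
    by (rule integral_dominated_convergence[where w = "\<lambda>_. B"]) (use Fm Fb Flim in auto)
  then have "(\<lambda>k. \<integral>x. H x \<partial>L (k + K)) \<longlonglongrightarrow> (\<integral>x. H x \<partial>free_field)"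
    by (simp add: mix G.prob_space)
  then show ?thesis by (rule LIMSEQ_offset)
qed

section \<open>Measurability on the space of overlap structures\<close>

text \<open>By monotonicity the first \<open>i + 1\<close> entries are all at least
  \<open>s i\<close>, and together they are at most 1.\<close>

lemma mass_partition_le_inverse:
  assumes "s \<in> mass_partitions"
  shows "s i \<le> 1 / (real i + 1)"
proof -
  have "(real i + 1) * s i = (\<Sum>j<Suc i. s i)" by simp
  also have "\<dots> \<le> (\<Sum>j<Suc i. s j)"
    using assms by (intro sum_mono) (auto simp: mass_partitions_def decseq_def)
  also have "\<dots> \<le> (\<Sum>j. s j)"
    using assms by (intro sum_le_suminf) (auto simp: mass_partitions_def)
  also have "\<dots> \<le> 1" using assms by (auto simp: mass_partitions_def)
  finally show ?thesis by (simp add: field_simps)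
qed

lemma mass_openin_subset: "openin mass.mtopology U \<Longrightarrow> U \<subseteq> mass_partitions"
  using openin_subset[of mass.mtopology U] by simp

lemma mass_openin_Pow: "{U. openin mass.mtopology U} \<subseteq> Pow mass_partitions"
  using mass_openin_subset by auto

lemma space_mass_partition_space: "space mass_partition_space = mass_partitions"
  unfolding mass_partition_space_def
  by (rule space_measure_of[OF mass_openin_Pow])

text \<open>The supremum metric induces the product topology because a mass-partition \<open>s\<close> satisfies
  \<open>s i \<le> 1 / (i + 1)\<close>.\<close>

lemma mass_open_eq_product_open:
  assumes "openin mass.mtopology U"
  obtains V where "open V" "U = V \<inter> mass_partitions"
proof -
  have "\<exists>W. open W \<and> s \<in> W \<and> W \<inter> mass_partitions \<subseteq> U" if s: "s \<in> U" for s
  proof -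
    have sm: "s \<in> mass_partitions" using s assms mass_openin_subset by auto
    obtain e where e: "e > 0" "mass.mball s e \<subseteq> U"
      using assms s unfolding mass.openin_mtopology by blast
    obtain n :: nat where n: "1 / (real n + 1) < e / 2"
      using nat_approx_posE[of "e/2"] e(1) by (metis Suc_eq_plus1 half_gt_zero of_nat_1 of_nat_add)
    \<comment> \<open>From index \<open>n\<close> on all entries are below \<open>e / 2\<close>, so
      only finitely many coordinates need a constraint. The radius is \<open>e / 2\<close> because a
      supremum of values below \<open>e\<close> may equal \<open>e\<close>.\<close>
    define W where "W = {s'. \<forall>i\<in>{..<n}. s' i \<in> {s i - e/2<..<s i + e/2}}"
    have "W = (\<Inter>i\<in>{..<n}. (\<lambda>s'. s' i) -` {s i - e/2<..<s i + e/2})"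
      by (auto simp: W_def)
    then have "open W"
      by (auto intro!: open_INT open_vimage continuous_on_product_coordinates)
    moreover have "s \<in> W" using e by (auto simp: W_def)
    moreover have "W \<inter> mass_partitions \<subseteq> U"
    proof
      fix s' assume s': "s' \<in> W \<inter> mass_partitions"
      have "\<bar>s i - s' i\<bar> \<le> e / 2" for i
      proof (cases "i < n")
        case True
        then have "s' i \<in> {s i - e/2<..<s i + e/2}" using s' by (auto simp: W_def)
        then have "s i - e/2 < s' i" "s' i < s i + e/2" by auto
        then show ?thesis by linarith
      next
        case False
        then have "1 / (real i + 1) \<le> 1 / (real n + 1)" by (simp add: frac_le)
        moreover have "0 \<le> s i" "0 \<le> s' i" using sm s' by (auto simp: mass_partitions_def)
        moreover have "s i \<le> 1 / (real i + 1)" "s' i \<le> 1 / (real i + 1)"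
          using sm s' by (auto intro: mass_partition_le_inverse)
        ultimately show ?thesis using n by linarith
      qed
      then have "(SUP i. \<bar>s i - s' i\<bar>) \<le> e / 2" by (intro cSUP_least) auto
      then have "mass_dist s s' \<le> e / 2" using sm s' by (simp add: mass_dist_def)
      then show "s' \<in> U" using e sm s' by (auto simp: mass.mball_def)
    qed
    ultimately show ?thesis by blast
  qed
  then obtain W where W: "\<And>s. s \<in> U \<Longrightarrow> open (W s) \<and> s \<in> W s \<and> W s \<inter> mass_partitions \<subseteq> U"
    by metis
  have "U \<subseteq> mass_partitions" using assms by (rule mass_openin_subset)
  with W have "U = (\<Union>s\<in>U. W s) \<inter> mass_partitions" by blast
  moreover have "open (\<Union>s\<in>U. W s)" using W by blast
  ultimately show thesis using that by blast
qed

lemma measurable_mass_partition_coord: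
  "(\<lambda>s. s i) \<in> borel_measurable mass_partition_space"
proof (rule borel_measurableI_greater)
  fix a :: real
  have "openin mass.mtopology {s\<in>mass_partitions. a < s i}"
    unfolding mass.openin_mtopology
  proof safe
    fix s assume s: "s \<in> mass_partitions" "a < s i"
    have "mass.mball s (s i - a) \<subseteq> {s \<in> mass_partitions. a < s i}"
    proof
      fix x assume x: "x \<in> mass.mball s (s i - a)"
      then show "x \<in> {s \<in> mass_partitions. a < s i}"
        using mass_diff_le_dist[of s x i] by (auto simp: mass.mball_def)
    qed
    then show "\<exists>r>0. mass.mball s r \<subseteq> {s \<in> mass_partitions. a < s i}"
      using s by (intro exI[of _ "s i - a"]) auto
  qed
  then have "{s\<in>mass_partitions. a < s i} \<in> sigma_sets mass_partitions {U. openin mass.mtopology U}"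
    by (intro sigma_sets.Basic) auto
  then show "{x \<in> space mass_partition_space. a < x i} \<in> sets mass_partition_space"
    unfolding space_mass_partition_space
    by (simp add: mass_partition_space_def sets_measure_of[OF mass_openin_Pow])
qed

text \<open>Reduces measurability for the Borel sets of the metric to coordinates, since its open
  sets are traces of product-open sets.\<close>

lemma measurable_mass_partition_spaceI:
  assumes "\<And>x. x \<in> space N \<Longrightarrow> f x \<in> mass_partitions"
    and "\<And>i. (\<lambda>x. f x i) \<in> borel_measurable N"
  shows "f \<in> N \<rightarrow>\<^sub>M mass_partition_space"
  unfolding mass_partition_space_def
proof (rule measurable_measure_of)
  show "{U. openin mass.mtopology U} \<subseteq> Pow mass_partitions" by (rule mass_openin_Pow)
  show "f \<in> space N \<rightarrow> mass_partitions" using assms by auto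
  fix U assume "U \<in> {U. openin mass.mtopology U}"
  then obtain V where V: "open V" "U = V \<inter> mass_partitions" using mass_open_eq_product_open by auto
  have "f \<in> borel_measurable N" using assms(2) by (rule measurable_coordinatewise_then_product)
  then have "f -` V \<inter> space N \<in> sets N" using V by (intro measurable_sets) auto
  moreover have "f -` U \<inter> space N = f -` V \<inter> space N" using assms(1) V by auto
  ultimately show "f -` U \<inter> space N \<in> sets N" by simp
qed

lemma space_overlap_matrix_space: "space overlap_matrix_space = overlap_matrices"
  by (simp add: overlap_matrix_space_def space_restrict_space)

lemma measurable_overlap_matrix_coord:
  "(\<lambda>Q. Q i j) \<in> borel_measurable overlap_matrix_space"
proof -
  have "continuous_on UNIV (\<lambda>Q::nat \<Rightarrow> nat \<Rightarrow> real. Q i)"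
    by (rule continuous_on_product_coordinates)
  then have "continuous_on UNIV (\<lambda>Q::nat \<Rightarrow> nat \<Rightarrow> real. Q i j)"
    by (rule continuous_on_product_then_coordinatewise)
  then have "(\<lambda>Q::nat \<Rightarrow> nat \<Rightarrow> real. Q i j) \<in> borel_measurable borel"
    by (rule borel_measurable_continuous_onI)
  then show ?thesis unfolding overlap_matrix_space_def by (rule measurable_restrict_space1)
qed

lemma space_overlap_space: "space overlap_space = mass_partitions \<times> overlap_matrices"
  by (simp add: overlap_space_def space_pair_measure space_mass_partition_space
      space_overlap_matrix_space)

lemma measurable_overlap_space_fst [measurable]:
  "(\<lambda>s. fst s i) \<in> borel_measurable overlap_space"
  unfolding overlap_space_def
  by (rule measurable_compose[OF measurable_fst measurable_mass_partition_coord])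

lemma measurable_overlap_space_snd [measurable]:
  "(\<lambda>s. snd s i j) \<in> borel_measurable overlap_space"
  unfolding overlap_space_def
  by (rule measurable_compose[OF measurable_snd measurable_overlap_matrix_coord])

lemma measurable_overlap_spaceI:
  assumes "\<And>x. x \<in> space N \<Longrightarrow> f x \<in> space overlap_space"
    and "\<And>i. (\<lambda>x. fst (f x) i) \<in> borel_measurable N"
    and "\<And>i j. (\<lambda>x. snd (f x) i j) \<in> borel_measurable N"
  shows "f \<in> N \<rightarrow>\<^sub>M overlap_space"
proof -
  have "(\<lambda>x. fst (f x)) \<in> N \<rightarrow>\<^sub>M mass_partition_space"
    using assms by (intro measurable_mass_partition_spaceI) (auto simp: space_overlap_space mem_Times_iff)
  moreover have "(\<lambda>x. snd (f x)) \<in> N \<rightarrow>\<^sub>M overlap_matrix_space"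
    unfolding overlap_matrix_space_def
    using assms by (intro measurable_restrict_space2 measurable_coordinatewise_then_product)
      (auto simp: space_overlap_space mem_Times_iff)
  ultimately have "(\<lambda>x. (fst (f x), snd (f x))) \<in> N \<rightarrow>\<^sub>M overlap_space"
    unfolding overlap_space_def by (rule measurable_Pair)
  then show ?thesis by simp
qed

section \<open>Decreasing rearrangement\<close>

definition before :: "(nat \<Rightarrow> real) \<Rightarrow> nat \<Rightarrow> nat \<Rightarrow> bool" where
  "before w j i \<longleftrightarrow> w j > w i \<or> (w j = w i \<and> j < i)"

lemma rearrangement_before: "rearrangement w i = card {j. before w j i}"
  by (simp add: rearrangement_def before_def)

lemma before_trans: "before w i j \<Longrightarrow> before w j k \<Longrightarrow> before w i k"
  by (auto simp: before_def)

lemma before_irrefl: "\<not> before w i i"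
  by (simp add: before_def)

lemma before_total: "i \<noteq> j \<Longrightarrow> before w i j \<or> before w j i"
  by (auto simp: before_def)

text \<open>These conditions leave each index only finitely many predecessors: for a positive weight
  by summability, for a zero weight because nothing positive comes after it.\<close>

definition orderable :: "(nat \<Rightarrow> real) \<Rightarrow> bool" where
  "orderable w \<longleftrightarrow> (\<forall>i. 0 \<le> w i) \<and> summable w \<and> (\<forall>i j. i \<le> j \<longrightarrow> w i = 0 \<longrightarrow> w j = 0)"

lemma finite_before:
  assumes "orderable w"
  shows "finite {j. before w j i}"
proof (cases "w i = 0")
  case True
  have "{j. before w j i} \<subseteq> {..i}"
    using assms True unfolding orderable_def before_def by (metis (mono_tags, lifting) atMost_iff
        mem_Collect_eq nat_le_linear order_less_irrefl subsetI less_imp_le_nat)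
  then show ?thesis by (rule finite_subset) simp
next
  case False
  have "w \<longlonglongrightarrow> 0" using assms by (auto simp: orderable_def intro: summable_LIMSEQ_zero)
  moreover have "w i > 0" using assms False by (simp add: orderable_def less_le)
  ultimately have "eventually (\<lambda>j. w j < w i) sequentially" by (rule order_tendstoD)
  then obtain N where N: "\<And>j. j \<ge> N \<Longrightarrow> w j < w i" by (auto simp: eventually_sequentially)
  have "{j. before w j i} \<subseteq> {..<N}"
  proof
    fix j assume "j \<in> {j. before w j i}"
    then have "w j \<ge> w i" by (auto simp: before_def)
    then show "j \<in> {..<N}" using N[of j] by (cases "N \<le> j") auto
  qed
  then show ?thesis by (rule finite_subset) simp
qed

lemma rearrangement_less:
  assumes "orderable w" "before w j i"
  shows "rearrangement w j < rearrangement w i"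
  unfolding rearrangement_before
proof (rule psubset_card_mono[OF finite_before[OF assms(1)]])
  show "{k. before w k j} \<subset> {k. before w k i}"
    using assms(2) before_trans before_irrefl by blast
qed

text \<open>The predecessors of \<open>i\<close> have distinct ranks below that of \<open>i\<close>,
  and there are as many of them as the rank says, so they fill all smaller ranks. The range is thus
  closed downwards, and by injectivity it is infinite.\<close>

lemma bij_rearrangement:
  assumes w: "orderable w"
  shows "bij (rearrangement w)"
proof -
  let ?r = "rearrangement w"
  have inj: "inj ?r"
  proof (rule injI)
    fix i j assume "?r i = ?r j"
    then show "i = j" using before_total[of i j w] rearrangement_less[OF w] by fastforce
  qed
  have down: "k \<in> range ?r" if "k < ?r i" for i k
  proof -
    have "?r ` {j. before w j i} \<subseteq> {..<?r i}" using rearrangement_less[OF w] by auto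
    moreover have "card (?r ` {j. before w j i}) = ?r i"
      by (subst card_image) (use inj in \<open>auto intro: inj_on_subset simp: rearrangement_before\<close>)
    ultimately have "?r ` {j. before w j i} = {..<?r i}"
      by (intro card_subset_eq) auto
    then have "k \<in> ?r ` {j. before w j i}" using that by simp
    then show ?thesis by blast
  qed
  have "k \<in> range ?r" for k
  proof -
    have "infinite (range ?r)" using inj by (simp add: finite_image_iff)
    then have "\<not> range ?r \<subseteq> {..k}" using finite_subset by blast
    then obtain i where "?r i > k" by (auto simp: image_subset_iff not_le)
    then show ?thesis by (rule down)
  qed
  then show ?thesis using inj by (auto simp: bij_def)
qed

lemma rearrange_eq:
  "fst (rearrange w Q) p = w (inv (rearrangement w) p)"
  "snd (rearrange w Q) p q = Q (inv (rearrangement w) p) (inv (rearrangement w) q)"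
  by (simp_all add: rearrange_def Let_def)

lemma rearrange_mass_partition:
  assumes w: "orderable w" and "(\<Sum>i. w i) \<le> 1"
  shows "fst (rearrange w Q) \<in> mass_partitions"
proof -
  let ?\<rho> = "inv (rearrangement w)"
  have r: "rearrangement w (?\<rho> p) = p" for p
    using bij_rearrangement[OF w] by (simp add: bij_is_surj surj_f_inv_f)
  have inj: "inj ?\<rho>" using bij_rearrangement[OF w] by (simp add: bij_imp_bij_inv bij_is_inj)
  have "w (?\<rho> q) \<le> w (?\<rho> p)" if "p \<le> q" for p q
  proof (rule ccontr)
    assume "\<not> ?thesis"
    then have "before w (?\<rho> q) (?\<rho> p)" by (simp add: before_def)
    then show False using rearrangement_less[OF w] r that by fastforce
  qed
  moreover have "summable (w \<circ> ?\<rho>)"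
    using w inj by (intro summable_reindex) (auto simp: orderable_def)
  moreover have "suminf (w \<circ> ?\<rho>) \<le> suminf w"
    using w inj by (intro suminf_reindex_mono) (auto simp: orderable_def)
  ultimately show ?thesis
    using w assms(2) by (simp add: mass_partitions_def rearrange_def Let_def decseq_def orderable_def comp_def)
qed

lemma psd_matrix_reindex:
  assumes Q: "psd_matrix Q" and \<rho>: "inj \<rho>"
  shows "psd_matrix (\<lambda>m n. Q (\<rho> m) (\<rho> n))"
  unfolding psd_matrix_def
proof (intro conjI allI impI)
  fix i j show "Q (\<rho> i) (\<rho> j) = Q (\<rho> j) (\<rho> i)" using Q by (simp add: psd_matrix_def)
next
  fix I :: "nat set" and t :: "nat \<Rightarrow> real" assume I: "finite I"
  have "0 \<le> (\<Sum>i\<in>\<rho> ` I. \<Sum>j\<in>\<rho> ` I. t (inv \<rho> i) * t (inv \<rho> j) * Q i j)"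
    using Q[unfolded psd_matrix_def, THEN conjunct2, rule_format, of "\<rho> ` I" "\<lambda>i. t (inv \<rho> i)"] I
    by simp
  also have "\<dots> = (\<Sum>i\<in>I. \<Sum>j\<in>I. t i * t j * Q (\<rho> i) (\<rho> j))"
    using \<rho> by (simp add: sum.reindex inj_on_subset[OF \<rho>] inv_f_f)
  finally show "0 \<le> (\<Sum>i\<in>I. \<Sum>j\<in>I. t i * t j * Q (\<rho> i) (\<rho> j))" .
qed

lemma rearrange_overlap_matrix:
  assumes "orderable w" "Q \<in> overlap_matrices"
  shows "snd (rearrange w Q) \<in> overlap_matrices"
  using assms bij_imp_bij_inv[OF bij_rearrangement[OF assms(1)]]
  by (auto simp: overlap_matrices_def rearrange_def Let_def bij_is_inj intro: psd_matrix_reindex)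

lemma rearrangement_scale:
  assumes "c > 0"
  shows "rearrangement (\<lambda>i. w i / c) = rearrangement w"
  using assms by (intro ext) (auto simp: rearrangement_def divide_less_cancel)

lemma orderable_scale:
  assumes "orderable w" "c > 0"
  shows "orderable (\<lambda>i. w i / c)"
  using assms by (auto simp: orderable_def summable_divide)

text \<open>An index of rank \<open>p < m\<close> weighs more than \<open>d\<close>, as otherwise
  the \<open>m\<close> heavy indices would all precede it. It and its predecessors therefore lie
  below \<open>n\<close>, so the cut leaves its set of predecessors, and with it the rank,
  unchanged, ties included.\<close>

lemma inv_rearrangement_truncate:
  assumes w: "orderable w" and big: "\<And>i. i < m \<Longrightarrow> w i > d" and small: "\<And>j. j \<ge> n \<Longrightarrow> w j \<le> d"
    and p: "p < m" and d: "d \<ge> 0"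
  shows "inv (rearrangement (\<lambda>i. if i < n then w i else 0)) p = inv (rearrangement w) p"
    and "inv (rearrangement w) p < n"
proof -
  let ?v = "\<lambda>i. if i < n then w i else 0"
  have "summable ?v"
    by (rule summable_comparison_test'[of w 0]) (use w in \<open>auto simp: orderable_def\<close>)
  then have v: "orderable ?v" using w by (auto simp: orderable_def)
  define i where "i = inv (rearrangement w) p"
  have i: "rearrangement w i = p" unfolding i_def
    using bij_rearrangement[OF w] by (simp add: bij_is_surj surj_f_inv_f)
  have wi: "w i > d"
  proof (rule ccontr)
    assume "\<not> ?thesis"
    then have "{..<m} \<subseteq> {j. before w j i}" using big by (force simp: before_def)
    then have "m \<le> rearrangement w i"
      using card_mono[OF finite_before[OF w], of "{..<m}"] by (simp add: rearrangement_before)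
    then show False using i p by simp
  qed
  have nn: "i < n" using wi small[of i] by (cases "n \<le> i") auto
  then show "inv (rearrangement w) p < n" by (simp add: i_def)
  have "before ?v j i \<longleftrightarrow> before w j i" for j
    using nn wi small[of j] d by (cases "j < n") (auto simp: before_def)
  then have "rearrangement ?v i = p" using i by (simp add: rearrangement_before)
  then show "inv (rearrangement ?v) p = inv (rearrangement w) p"
    unfolding i_def[symmetric] by (rule inv_f_eq[OF bij_is_inj[OF bij_rearrangement[OF v]]])
qed

section \<open>Measurability of the evolution\<close>

text \<open>The value 0 in the divergent case makes the weights \<open>orderable\<close>
  unconditionally, so their ranking is always a bijection.\<close>

definition evolved_weights :: "(real \<Rightarrow> real) \<Rightarrow> (nat \<Rightarrow> real) \<Rightarrow> (nat \<Rightarrow> real) \<Rightarrow> nat \<Rightarrow> real" where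
  "evolved_weights \<psi> \<kappa> \<xi> i =
     (if summable (\<lambda>j. \<xi> j * exp (\<psi> (\<kappa> j))) then \<xi> i * exp (\<psi> (\<kappa> i)) / (\<Sum>j. \<xi> j * exp (\<psi> (\<kappa> j))) else 0)"

lemma evolve_eq:
  "evolve \<psi> \<kappa> s = (if summable (\<lambda>j. fst s j * exp (\<psi> (\<kappa> j)))
     then rearrange (evolved_weights \<psi> \<kappa> (fst s)) (snd s) else s)"
  by (auto simp: evolve_def evolved_weights_def[abs_def] split_beta)

lemma orderable_weights:
  assumes "\<xi> \<in> mass_partitions" "summable (\<lambda>j. \<xi> j * exp (\<psi> (\<kappa> j)))"
  shows "orderable (\<lambda>j. \<xi> j * exp (\<psi> (\<kappa> j)))"
  unfolding orderable_def
proof (intro conjI allI impI)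
  fix i j :: nat assume "i \<le> j" "\<xi> i * exp (\<psi> (\<kappa> i)) = 0"
  then have "\<xi> j \<le> 0" "0 \<le> \<xi> j" using assms(1) by (auto simp: mass_partitions_def decseq_def)
      (metis)
  then show "\<xi> j * exp (\<psi> (\<kappa> j)) = 0" by simp
qed (use assms in \<open>auto simp: mass_partitions_def\<close>)

lemma evolved_weights:
  assumes "\<xi> \<in> mass_partitions"
  shows "orderable (evolved_weights \<psi> \<kappa> \<xi>)" "(\<Sum>i. evolved_weights \<psi> \<kappa> \<xi> i) \<le> 1"
proof -
  have "orderable (evolved_weights \<psi> \<kappa> \<xi>) \<and> (\<Sum>i. evolved_weights \<psi> \<kappa> \<xi> i) \<le> 1"
  proof (cases "summable (\<lambda>j. \<xi> j * exp (\<psi> (\<kappa> j))) \<and> (\<Sum>j. \<xi> j * exp (\<psi> (\<kappa> j))) \<noteq> 0")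
    case True
    then have o: "orderable (\<lambda>j. \<xi> j * exp (\<psi> (\<kappa> j)))" using assms orderable_weights by auto
    have "(\<Sum>j. \<xi> j * exp (\<psi> (\<kappa> j))) > 0"
      using True o by (simp add: suminf_nonneg orderable_def less_le)
    then show ?thesis using True orderable_scale[OF o]
      by (simp add: evolved_weights_def[abs_def] suminf_divide)
  next
    case False
    \<comment> \<open>Both degenerate cases give zero weights: divergence by definition, total mass
      0 because division by zero yields 0.\<close>
    then have "evolved_weights \<psi> \<kappa> \<xi> = (\<lambda>_. 0)" by (auto simp: fun_eq_iff evolved_weights_def)
    then show ?thesis by (simp add: orderable_def)
  qed
  then show "orderable (evolved_weights \<psi> \<kappa> \<xi>)" "(\<Sum>i. evolved_weights \<psi> \<kappa> \<xi> i) \<le> 1" by auto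
qed

lemma evolve_in_overlap_space:
  assumes "s \<in> space overlap_space"
  shows "evolve \<psi> \<kappa> s \<in> space overlap_space"
  using assms rearrange_mass_partition[OF evolved_weights] rearrange_overlap_matrix[OF evolved_weights(1)]
  by (auto simp: evolve_eq space_overlap_space mem_Times_iff)

text \<open>Measurability is joint because \<open>evolved_law\<close> mixes over structure and
  field. The permutation makes the entries depend on a random index; as indices are countable, each
  value can be treated separately.\<close>

lemma measurable_evolve:
  assumes [measurable]: "\<psi> \<in> borel_measurable borel"
  shows "(\<lambda>(s, \<kappa>). evolve \<psi> \<kappa> s) \<in> overlap_space \<Otimes>\<^sub>M field_space \<rightarrow>\<^sub>M overlap_space"
proof -
  let ?N = "overlap_space \<Otimes>\<^sub>M field_space"
  define u where "u x j = fst (fst x) j * exp (\<psi> (snd x j))"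
    for x :: "overlap_structure \<times> (nat \<Rightarrow> real)" and j
  define w where "w x = evolved_weights \<psi> (snd x) (fst (fst x))"
    for x :: "overlap_structure \<times> (nat \<Rightarrow> real)"
  have [measurable]: "(\<lambda>x. fst (fst x) j) \<in> borel_measurable ?N" "(\<lambda>x. snd (fst x) j k) \<in> borel_measurable ?N"
    "(\<lambda>x. snd x j) \<in> borel_measurable ?N" for j k
    by measurable
  have u [measurable]: "(\<lambda>x. u x j) \<in> borel_measurable ?N" for j
    unfolding u_def by measurable
  have sp: "fst (fst x) \<in> mass_partitions" if "x \<in> space ?N" for x
    using that by (auto simp: space_pair_measure space_overlap_space)
  have pos: "0 \<le> u x j" if "x \<in> space ?N" for x j
    using sp[OF that] by (auto simp: u_def mass_partitions_def)
  \<comment> \<open>Summability of nonnegative terms is rewritten as finiteness of a sum in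
    \<open>ennreal\<close>, which is a measurable condition.\<close>
  have sm: "Measurable.pred ?N (\<lambda>x. summable (u x))"
  proof (subst measurable_cong)
    fix x assume x: "x \<in> space ?N"
    show "summable (u x) \<longleftrightarrow> (\<Sum>j. ennreal (u x j)) \<noteq> top"
      using pos[OF x] by (auto intro: summable_suminf_not_top dest: ennreal_suminf_neq_top)
  qed measurable
  note sm [measurable]
  have w_eq: "w x j = (if summable (u x) then u x j / suminf (u x) else 0)" for x j
    by (simp add: w_def u_def[abs_def] evolved_weights_def)
  have w [measurable]: "(\<lambda>x. w x j) \<in> borel_measurable ?N" for j
    unfolding w_eq by measurable
  have rank [measurable]: "(\<lambda>x. rearrangement (w x) i) \<in> ?N \<rightarrow>\<^sub>M count_space UNIV" for i
    unfolding rearrangement_def by measurable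
  have bij: "bij (rearrangement (w x))" if "x \<in> space ?N" for x
    unfolding w_def by (rule bij_rearrangement[OF evolved_weights(1)[OF sp[OF that]]])
  have inv [measurable]: "(\<lambda>x. inv (rearrangement (w x)) p) \<in> ?N \<rightarrow>\<^sub>M count_space UNIV" for p
  proof (subst measurable_cong)
    fix x assume x: "x \<in> space ?N"
    have "rearrangement (w x) (inv (rearrangement (w x)) p) = p"
      using bij[OF x] by (simp add: bij_is_surj surj_f_inv_f)
    \<comment> \<open>The index of rank \<open>p\<close> is unique, so the inverse is a
      \<open>LEAST\<close> expression, measurable because the ranks are.\<close>
    then show "inv (rearrangement (w x)) p = (LEAST i. rearrangement (w x) i = p)"
      by (intro inv_f_eq[OF bij_is_inj[OF bij[OF x]]] LeastI[of "\<lambda>i. rearrangement (w x) i = p"])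
  qed measurable
  show ?thesis
  proof (rule measurable_overlap_spaceI)
    fix x assume "x \<in> space ?N"
    then show "(case x of (s, \<kappa>) \<Rightarrow> evolve \<psi> \<kappa> s) \<in> space overlap_space"
      by (auto simp: space_pair_measure intro: evolve_in_overlap_space)
  next
    fix p
    have "(\<lambda>x. w x (inv (rearrangement (w x)) p)) \<in> borel_measurable ?N"
      by (rule measurable_compose_countable[OF w inv])
    then have "(\<lambda>x. if summable (u x) then w x (inv (rearrangement (w x)) p) else fst (fst x) p) \<in> borel_measurable ?N"
      by measurable
    then show "(\<lambda>x. fst (case x of (s, \<kappa>) \<Rightarrow> evolve \<psi> \<kappa> s) p) \<in> borel_measurable ?N"
      by (rule back_subst[of "\<lambda>f. f \<in> _"])
        (auto simp: fun_eq_iff evolve_eq rearrange_eq u_def[abs_def] w_def split_beta)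
  next
    fix p q
    have "(\<lambda>x. snd (fst x) j (inv (rearrangement (w x)) q)) \<in> borel_measurable ?N" for j
      by (rule measurable_compose_countable[OF _ inv]) measurable
    then have "(\<lambda>x. snd (fst x) (inv (rearrangement (w x)) p) (inv (rearrangement (w x)) q)) \<in> borel_measurable ?N"
      by (rule measurable_compose_countable[OF _ inv])
    then have "(\<lambda>x. if summable (u x) then snd (fst x) (inv (rearrangement (w x)) p) (inv (rearrangement (w x)) q)
        else snd (fst x) p q) \<in> borel_measurable ?N"
      by measurable
    then show "(\<lambda>x. snd (case x of (s, \<kappa>) \<Rightarrow> evolve \<psi> \<kappa> s) p q) \<in> borel_measurable ?N"
      by (rule back_subst[of "\<lambda>f. f \<in> _"])
        (auto simp: fun_eq_iff evolve_eq rearrange_eq u_def[abs_def] w_def split_beta)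
  qed
qed

section \<open>Truncation of the mass-partition\<close>

definition ramp :: "nat \<Rightarrow> real \<Rightarrow> real \<Rightarrow> real" where
  "ramp k a x = min 1 (max 0 (real k * (x - a)))"

lemma ramp_bounds: "0 \<le> ramp k a x" "ramp k a x \<le> 1"
  by (auto simp: ramp_def)

lemma ramp_lipschitz: "\<bar>ramp k a x - ramp k a y\<bar> \<le> real k * \<bar>x - y\<bar>"
proof -
  have "\<bar>ramp k a x - ramp k a y\<bar> \<le> \<bar>real k * (x - a) - real k * (y - a)\<bar>"
    unfolding ramp_def by linarith
  also have "\<dots> = \<bar>real k * (x - y)\<bar>" by (simp add: algebra_simps)
  finally show ?thesis by (simp add: abs_mult)
qed

lemma ramp_tendsto: "(\<lambda>k. ramp k a x) \<longlonglongrightarrow> indicator {a<..} x"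
proof (cases "a < x")
  case True
  obtain N where N: "1 / (x - a) < real N" using reals_Archimedean2 by blast
  have "ramp k a x = 1" if "k \<ge> N" for k
  proof -
    have "1 / (x - a) < real k" using N that by linarith
    then have "1 \<le> real k * (x - a)" using True by (simp add: field_simps)
    then show ?thesis by (simp add: ramp_def)
  qed
  then have "\<forall>\<^sub>F k in sequentially. ramp k a x = 1" by (auto simp: eventually_sequentially)
  then show ?thesis using True by (simp add: tendsto_eventually)
next
  case False
  then have "ramp k a x = 0" for k by (simp add: ramp_def mult_nonneg_nonpos max_absorb1)
  then show ?thesis using False by simp
qed

text \<open>Lipschitz in the weights, whose normalisation is disturbed by truncation, but sharp in
  the overlaps, whose leading block truncation leaves untouched on the event of
  \<open>evolve_truncate_close\<close>.\<close>

definition overlap_test ::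
  "nat \<Rightarrow> (nat \<Rightarrow> real) \<Rightarrow> (nat \<Rightarrow> nat \<Rightarrow> real set) \<Rightarrow> nat \<Rightarrow> overlap_structure \<Rightarrow> real" where
  "overlap_test k a B m s =
     (\<Prod>i<m. ramp k (a i) (fst s i)) * (\<Prod>i<m. \<Prod>j<m. indicator (B i j) (snd s i j))"

lemma measurable_overlap_test [measurable]:
  assumes [measurable]: "\<And>i j. B i j \<in> sets borel"
  shows "overlap_test k a B m \<in> borel_measurable overlap_space"
  unfolding overlap_test_def ramp_def by measurable

lemma overlap_test_bounds: "0 \<le> overlap_test k a B m s" "overlap_test k a B m s \<le> 1"
  unfolding overlap_test_def
  by (auto intro!: mult_nonneg_nonneg mult_le_one prod_nonneg prod_le_1 simp: ramp_bounds)

lemma overlap_test_diff: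
  assumes fst: "\<And>p. p < m \<Longrightarrow> \<bar>fst s p - fst s' p\<bar> \<le> e"
    and snd: "\<And>p q. p < m \<Longrightarrow> q < m \<Longrightarrow> snd s p q = snd s' p q"
  shows "\<bar>overlap_test k a B m s - overlap_test k a B m s'\<bar> \<le> real m * real k * e"
proof -
  let ?I = "\<Prod>i<m. \<Prod>j<m. indicator (B i j) (snd s i j) :: real"
  have I: "0 \<le> ?I" "?I \<le> 1" by (auto intro!: prod_nonneg prod_le_1)
  have "?I = (\<Prod>i<m. \<Prod>j<m. indicator (B i j) (snd s' i j))"
    by (intro prod.cong refl) (simp add: snd)
  then have "overlap_test k a B m s - overlap_test k a B m s'
      = ((\<Prod>i<m. ramp k (a i) (fst s i)) - (\<Prod>i<m. ramp k (a i) (fst s' i))) * ?I"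
    by (simp add: overlap_test_def left_diff_distrib)
  also have "\<bar>\<dots>\<bar> \<le> \<bar>(\<Prod>i<m. ramp k (a i) (fst s i)) - (\<Prod>i<m. ramp k (a i) (fst s' i))\<bar>"
    using I by (simp add: abs_mult mult_left_le)
  also have "\<dots> \<le> (\<Sum>i<m. \<bar>ramp k (a i) (fst s i) - ramp k (a i) (fst s' i)\<bar>)"
    using norm_prod_diff[of "{..<m}" "\<lambda>i. ramp k (a i) (fst s i)" "\<lambda>i. ramp k (a i) (fst s' i)"]
    by (simp add: ramp_bounds)
  also have "\<dots> \<le> (\<Sum>i<m. real k * e)"
    by (intro sum_mono order_trans[OF ramp_lipschitz] mult_left_mono fst) auto
  finally show ?thesis by (simp add: mult.assoc)
qed

section \<open>Effect of truncation on the evolved structure\<close>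

definition truncate :: "nat \<Rightarrow> (nat \<Rightarrow> real) \<Rightarrow> nat \<Rightarrow> real" where
  "truncate n \<xi> i = (if i < n then \<xi> i else 0)"

lemma truncate_mass_partition:
  assumes "\<xi> \<in> mass_partitions"
  shows "truncate n \<xi> \<in> mass_partitions"
proof -
  have \<xi>: "summable \<xi>" "\<And>i. 0 \<le> \<xi> i" "decseq \<xi>" "suminf \<xi> \<le> 1"
    using assms by (auto simp: mass_partitions_def)
  have sm: "summable (truncate n \<xi>)"
    by (rule summable_comparison_test'[OF \<xi>(1), of 0]) (simp add: truncate_def \<xi>)
  have "suminf (truncate n \<xi>) \<le> suminf \<xi>"
    by (intro suminf_le sm \<xi>) (simp add: truncate_def \<xi>)
  then show ?thesis using sm \<xi> by (auto simp: mass_partitions_def truncate_def decseq_def)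
qed

text \<open>The tail bound acts twice. Since \<open>\<delta> * e \<le> \<delta>\<close>, no single
  late weight exceeds \<open>\<delta>\<close>, so the top \<open>m\<close> ranks are unchanged.
  Since the retained mass exceeds \<open>\<delta>\<close>, the missing mass is at most a fraction
  \<open>e\<close> of it, which controls the normalisation.\<close>

lemma evolve_truncate_close:
  assumes \<xi>: "\<xi> \<in> mass_partitions"
    and sm: "summable (\<lambda>j. \<xi> j * exp (\<psi> (\<kappa> j)))"
    and big: "\<And>i. i < m \<Longrightarrow> \<xi> i * exp (\<psi> (\<kappa> i)) > \<delta>"
    and tail: "(\<Sum>j. \<xi> (j + n) * exp (\<psi> (\<kappa> (j + n)))) \<le> \<delta> * e"
    and pos: "\<delta> > 0" "0 < e" "e \<le> 1" and p: "p < m"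
  shows "\<bar>fst (evolve \<psi> \<kappa> (\<xi>, Q)) p - fst (evolve \<psi> \<kappa> (truncate n \<xi>, Q)) p\<bar> \<le> e"
    and "q < m \<Longrightarrow> snd (evolve \<psi> \<kappa> (\<xi>, Q)) p q = snd (evolve \<psi> \<kappa> (truncate n \<xi>, Q)) p q"
proof -
  define u where "u j = \<xi> j * exp (\<psi> (\<kappa> j))" for j
  define v where "v j = (if j < n then u j else 0)" for j
  have u: "orderable u" unfolding u_def[abs_def] using \<xi> sm by (rule orderable_weights[of \<xi> \<psi> \<kappa>])
  then have u0: "0 \<le> u j" and su: "summable u" for j by (auto simp: orderable_def)
  have vt: "truncate n \<xi> j * exp (\<psi> (\<kappa> j)) = v j" for j by (simp add: truncate_def v_def u_def)
  have sv: "v sums (\<Sum>j<n. u j)"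
    using sums_finite[of "{..<n}" v] by (simp add: v_def)
  define S where "S = suminf u"
  define T where "T = (\<Sum>j. u (j + n))"
  have ST: "S = T + (\<Sum>j<n. u j)" unfolding S_def T_def by (rule suminf_split_initial_segment[OF su])
  have stail: "summable (\<lambda>j. u (j + n))" using su by (rule summable_ignore_initial_segment)
  have T0: "0 \<le> T" unfolding T_def using u0 stail by (simp add: suminf_nonneg)
  have T: "T \<le> \<delta> * e" using tail by (simp add: T_def u_def)
  have small: "u j \<le> \<delta> * e" if "j \<ge> n" for j
  proof -
    have "u j = u (j - n + n)" using that by simp
    also have "\<dots> \<le> T" unfolding T_def using sum_le_suminf[OF stail, of "{j - n}"] u0 by simp
    finally show ?thesis using T by simp
  qed
  have de: "\<delta> * e \<le> \<delta>" using pos by (simp add: mult_left_le)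
  \<comment> \<open>As \<open>p < m\<close>, index 0 is among the heavy ones; it weighs more than
    the tail, so the truncation keeps it.\<close>
  have m0: "u 0 > \<delta>" using big[of 0] p by (simp add: u_def)
  have n0: "0 < n" using small[of 0] m0 de by (cases n) auto
  have Sn: "(\<Sum>j<n. u j) > \<delta>"
    using m0 member_le_sum[of 0 "{..<n}" u] u0 n0 by simp
  have S0: "S > 0" using Sn T0 ST pos by simp
  let ?\<rho> = "inv (rearrangement u)"
  have tr: "inv (rearrangement v) p = ?\<rho> p" "?\<rho> p < n" if "p < m" for p
  proof -
    have big': "i < m \<Longrightarrow> \<delta> < u i" for i using big by (simp add: u_def)
    have small': "n \<le> j \<Longrightarrow> u j \<le> \<delta>" for j using small de by fastforce
    show "inv (rearrangement v) p = ?\<rho> p" unfolding v_def[abs_def]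
      by (rule inv_rearrangement_truncate(1)[OF u, where d = \<delta> and m = m]) (use big' small' that pos in auto)
    show "?\<rho> p < n"
      by (rule inv_rearrangement_truncate(2)[OF u, where d = \<delta> and m = m]) (use big' small' that pos in auto)
  qed
  have w: "evolved_weights \<psi> \<kappa> \<xi> = (\<lambda>i. u i / S)"
    using sm by (auto simp: fun_eq_iff evolved_weights_def u_def[abs_def] S_def)
  have w': "evolved_weights \<psi> \<kappa> (truncate n \<xi>) = (\<lambda>i. v i / (\<Sum>j<n. u j))"
    using sums_summable[OF sv] sums_unique[OF sv] by (auto simp: fun_eq_iff evolved_weights_def vt)
  have e1: "evolve \<psi> \<kappa> (\<xi>, Q) = rearrange (\<lambda>i. u i / S) Q"
    using sm by (simp add: evolve_eq w)
  have e2: "evolve \<psi> \<kappa> (truncate n \<xi>, Q) = rearrange (\<lambda>i. v i / (\<Sum>j<n. u j)) Q"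
    using sums_summable[OF sv] by (simp add: evolve_eq w' vt)
  have r1: "rearrangement (\<lambda>i. u i / S) = rearrangement u" using S0 by (rule rearrangement_scale)
  have r2: "rearrangement (\<lambda>i. v i / (\<Sum>j<n. u j)) = rearrangement v"
    using Sn pos by (intro rearrangement_scale) simp
  show "q < m \<Longrightarrow> snd (evolve \<psi> \<kappa> (\<xi>, Q)) p q = snd (evolve \<psi> \<kappa> (truncate n \<xi>, Q)) p q"
    using p by (simp add: e1 e2 rearrange_eq r1 r2 tr)
  let ?i = "?\<rho> p" and ?Sn = "\<Sum>j<n. u j"
  have uS: "u ?i \<le> S" unfolding S_def using sum_le_suminf[OF su, of "{?i}"] u0 by simp
  have Sn0: "?Sn > 0" using Sn pos by simp
  \<comment> \<open>By \<open>ST\<close> the error is a normalised weight, at most 1, times the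
    relative missing mass.\<close>
  have "u ?i / ?Sn - u ?i / S = (u ?i / S) * (T / ?Sn)"
    using S0 Sn0 by (simp add: ST field_simps)
  moreover have "u ?i / S \<le> 1" "0 \<le> u ?i / S" using uS S0 u0 by auto
  moreover have "0 \<le> T / ?Sn" using T0 Sn0 by simp
  moreover have "T / ?Sn \<le> e"
  proof -
    have "T \<le> ?Sn * e" using Sn pos by (intro order_trans[OF T] mult_right_mono) auto
    then show ?thesis using Sn0 by (simp add: field_simps)
  qed
  moreover have "0 \<le> (u ?i / S) * (T / ?Sn)"
    using S0 Sn0 u0 T0 by (intro mult_nonneg_nonneg divide_nonneg_nonneg) auto
  ultimately have "0 \<le> u ?i / ?Sn - u ?i / S" "u ?i / ?Sn - u ?i / S \<le> e"
    using mult_mono[of "u ?i / S" 1 "T / ?Sn" e] by auto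
  then have "\<bar>u ?i / S - u ?i / ?Sn\<bar> \<le> e" by linarith
  then show "\<bar>fst (evolve \<psi> \<kappa> (\<xi>, Q)) p - fst (evolve \<psi> \<kappa> (truncate n \<xi>, Q)) p\<bar> \<le> e"
    unfolding e1 e2 rearrange_eq r1 r2 tr(1)[OF p] using tr(2)[OF p] by (simp add: v_def)
qed

lemma space_UNIV_of_sets_field: "sets L = sets field_space \<Longrightarrow> space L = UNIV"
  by (drule sets_eq_imp_space_eq) (simp add: space_PiM)

text \<open>A union bound over light leading weights and Markov's inequality for the tail control
  the event excluded in \<open>evolve_truncate_close\<close>. Both use only one-dimensional
  marginals, so the bound does not depend on \<open>L\<close>.\<close>

lemma truncation_error_bound:
  assumes \<psi> [measurable]: "\<psi> \<in> borel_measurable borel"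
    and int: "integrable lborel (\<lambda>z. std_normal_density z * exp (\<psi> z))"
    and L: "prob_space L" and sL [measurable_cong]: "sets L = sets field_space"
    and marg: "\<And>i. distr L borel (\<lambda>\<kappa>. \<kappa> i) = std_normal_distribution"
    and s: "(\<xi>, Q) \<in> space overlap_space" and B: "\<And>i j. B i j \<in> sets borel"
    and pos: "\<delta> > 0" "0 < e" "e \<le> 1"
  shows "\<bar>(\<integral>\<kappa>. overlap_test k a B m (evolve \<psi> \<kappa> (\<xi>, Q)) \<partial>L)
        - (\<integral>\<kappa>. overlap_test k a B m (evolve \<psi> \<kappa> (truncate n \<xi>, Q)) \<partial>L)\<bar>
    \<le> real m * real k * e + (\<Sum>i<m. measure std_normal_distribution {x. \<xi> i * exp (\<psi> x) \<le> \<delta>})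
      + (\<integral>z. std_normal_density z * exp (\<psi> z) \<partial>lborel) * (\<Sum>j. \<xi> (j + n)) / (\<delta> * e)"
    (is "\<bar>?I1 - ?I2\<bar> \<le> _ + ?P + ?E * _ / _")
proof -
  interpret L: prob_space L by fact
  interpret N: prob_space std_normal_distribution by simp
  have \<xi>: "\<xi> \<in> mass_partitions" and Q: "Q \<in> overlap_matrices" using s by (auto simp: space_overlap_space)
  have \<xi>0: "0 \<le> \<xi> i" for i using \<xi> by (simp add: mass_partitions_def)
  have s': "(truncate n \<xi>, Q) \<in> space overlap_space"
    using truncate_mass_partition[OF \<xi>] Q by (simp add: space_overlap_space)
  note [measurable] = B
  have em: "(\<lambda>\<kappa>. evolve \<psi> \<kappa> s) \<in> L \<rightarrow>\<^sub>M overlap_space" if "s \<in> space overlap_space" for s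
    using measurable_compose[OF measurable_Pair1'[OF that] measurable_evolve[OF \<psi>]]
    by (simp add: measurable_cong_sets[OF sL refl])
  define F1 where "F1 \<kappa> = overlap_test k a B m (evolve \<psi> \<kappa> (\<xi>, Q))" for \<kappa>
  define F2 where "F2 \<kappa> = overlap_test k a B m (evolve \<psi> \<kappa> (truncate n \<xi>, Q))" for \<kappa>
  have [measurable]: "F1 \<in> borel_measurable L" "F2 \<in> borel_measurable L"
    unfolding F1_def F2_def using em[OF s] em[OF s'] by measurable
  have i12: "integrable L F1" "integrable L F2"
    by (auto intro!: L.integrable_const_bound[of _ 1] simp: F1_def F2_def overlap_test_bounds)
  define u where "u \<kappa> j = \<xi> j * exp (\<psi> (\<kappa> j))" for \<kappa> j
  have u0: "0 \<le> u \<kappa> j" for \<kappa> j using \<xi>0 by (simp add: u_def)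
  define T where "T \<kappa> = (\<Sum>j. ennreal (u \<kappa> (j + n)))" for \<kappa>
  \<comment> \<open>A pointwise Markov inequality: on the good event the first summand is enough;
    elsewhere the difference is at most 1, and either some indicator equals 1 or
    \<open>T \<kappa>\<close> is at least \<open>\<delta> * e\<close>.\<close>
  let ?R = "\<lambda>\<kappa>. ennreal (real m * real k * e) + (\<Sum>i<m. indicator {\<kappa>. u \<kappa> i \<le> \<delta>} \<kappa>) + ennreal (1 / (\<delta> * e)) * T \<kappa>"
  \<comment> \<open>If the weights are not summable then \<open>T \<kappa> = \<infinity>\<close>, so the bound needs no exceptional null set.\<close>
  have pw: "ennreal \<bar>F1 \<kappa> - F2 \<kappa>\<bar> \<le> ?R \<kappa>" for \<kappa>
  proof (cases "summable (u \<kappa>) \<and> (\<forall>i<m. u \<kappa> i > \<delta>) \<and> (\<Sum>j. u \<kappa> (j + n)) \<le> \<delta> * e")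
    case True
    then have "\<bar>F1 \<kappa> - F2 \<kappa>\<bar> \<le> real m * real k * e"
      unfolding F1_def F2_def u_def[abs_def]
      by (intro overlap_test_diff evolve_truncate_close[where \<delta> = \<delta> and e = e] \<xi> pos) auto
    then have "ennreal \<bar>F1 \<kappa> - F2 \<kappa>\<bar> \<le> ennreal (real m * real k * e)" by (rule ennreal_leI)
    also have "\<dots> \<le> ?R \<kappa>" by (simp add: add.assoc)
    finally show ?thesis .
  next
    case False
    have "\<bar>F1 \<kappa> - F2 \<kappa>\<bar> \<le> 1"
      using overlap_test_bounds[of k a B m] by (simp add: F1_def F2_def abs_le_iff) (smt (verit))
    then have le1: "ennreal \<bar>F1 \<kappa> - F2 \<kappa>\<bar> \<le> 1" using ennreal_leI by fastforce
    have "1 \<le> (\<Sum>i<m. indicator {\<kappa>. u \<kappa> i \<le> \<delta>} \<kappa>) + ennreal (1 / (\<delta> * e)) * T \<kappa>"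
    proof (cases "\<forall>i<m. u \<kappa> i > \<delta>")
      case no: False
      then obtain i where "i < m" "u \<kappa> i \<le> \<delta>" by (auto simp: not_less)
      then have "(1::ennreal) \<le> (\<Sum>i<m. indicator {\<kappa>. u \<kappa> i \<le> \<delta>} \<kappa>)"
        using member_le_sum[of i "{..<m}" "\<lambda>i. indicator {\<kappa>. u \<kappa> i \<le> \<delta>} \<kappa> :: ennreal"] by simp
      then show ?thesis by (rule order_trans) simp
    next
      case yes: True
      have "ennreal (\<delta> * e) \<le> T \<kappa>"
      proof (cases "summable (u \<kappa>)")
        case True
        then have "(\<Sum>j. u \<kappa> (j + n)) > \<delta> * e" using False yes by simp
        moreover have "T \<kappa> = ennreal (\<Sum>j. u \<kappa> (j + n))"
          unfolding T_def using u0 True by (intro suminf_ennreal2 summable_ignore_initial_segment) auto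
        ultimately show ?thesis by (simp add: ennreal_leI)
      next
        case False
        then have "\<not> summable (\<lambda>j. u \<kappa> (j + n))" by (simp add: summable_iff_shift)
        then have "T \<kappa> = top" unfolding T_def using summable_suminf_not_top[of "\<lambda>j. u \<kappa> (j + n)"] u0 by blast
        then show ?thesis by simp
      qed
      then have "ennreal (1 / (\<delta> * e)) * ennreal (\<delta> * e) \<le> ennreal (1 / (\<delta> * e)) * T \<kappa>"
        by (rule mult_left_mono) simp
      moreover have "ennreal (1 / (\<delta> * e)) * ennreal (\<delta> * e) = 1"
        using pos by (subst ennreal_mult[symmetric]) auto
      ultimately show ?thesis by (simp add: add_increasing)
    qed
    then have "1 \<le> ?R \<kappa>" by (simp add: add.assoc add_increasing)
    with le1 show ?thesis by (rule order_trans)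
  qed
  have spL: "space L = UNIV" using sL by (rule space_UNIV_of_sets_field)
  have [measurable]: "(\<lambda>\<kappa>. u \<kappa> j) \<in> borel_measurable L" for j unfolding u_def by measurable
  have set [measurable]: "{\<kappa>. u \<kappa> i \<le> \<delta>} \<in> sets L" for i
  proof -
    have "{\<kappa> \<in> space L. u \<kappa> i \<le> \<delta>} \<in> sets L" by measurable
    then show ?thesis by (simp add: spL)
  qed
  have nE: "(\<integral>\<^sup>+\<kappa>. ennreal (exp (\<psi> (\<kappa> j))) \<partial>L) = ennreal ?E" for j
  proof -
    have "(\<integral>\<^sup>+\<kappa>. ennreal (exp (\<psi> (\<kappa> j))) \<partial>L) = (\<integral>\<^sup>+x. ennreal (exp (\<psi> x)) \<partial>distr L borel (\<lambda>\<kappa>. \<kappa> j))"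
      by (subst nn_integral_distr) auto
    also have "\<dots> = (\<integral>\<^sup>+z. ennreal (std_normal_density z * exp (\<psi> z)) \<partial>lborel)"
      unfolding marg by (subst nn_integral_density) (auto simp: ennreal_mult)
    also have "\<dots> = ennreal ?E" using int by (intro nn_integral_eq_integral) auto
    finally show ?thesis .
  qed
  have E0: "0 \<le> ?E" by (intro integral_nonneg_AE) auto
  have "(\<integral>\<^sup>+\<kappa>. T \<kappa> \<partial>L) = (\<Sum>j. \<integral>\<^sup>+\<kappa>. ennreal (u \<kappa> (j + n)) \<partial>L)"
    unfolding T_def by (rule nn_integral_suminf) measurable
  also have "\<dots> = (\<Sum>j. ennreal (?E * \<xi> (j + n)))"
  proof (rule suminf_cong)
    fix j
    have "(\<integral>\<^sup>+\<kappa>. ennreal (u \<kappa> (j + n)) \<partial>L) = ennreal (\<xi> (j + n)) * (\<integral>\<^sup>+\<kappa>. ennreal (exp (\<psi> (\<kappa> (j + n)))) \<partial>L)"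
      by (subst nn_integral_cmult[symmetric]) (auto simp: u_def ennreal_mult \<xi>0)
    then show "(\<integral>\<^sup>+\<kappa>. ennreal (u \<kappa> (j + n)) \<partial>L) = ennreal (?E * \<xi> (j + n))"
      using E0 \<xi>0 by (simp add: nE ennreal_mult[symmetric] mult.commute)
  qed
  also have "\<dots> = ennreal (\<Sum>j. ?E * \<xi> (j + n))"
    using \<xi> E0 \<xi>0 by (intro suminf_ennreal2 summable_mult summable_ignore_initial_segment)
      (auto simp: mass_partitions_def)
  also have "(\<Sum>j. ?E * \<xi> (j + n)) = ?E * (\<Sum>j. \<xi> (j + n))"
    using \<xi> by (intro suminf_mult summable_ignore_initial_segment) (auto simp: mass_partitions_def)
  finally have nT: "(\<integral>\<^sup>+\<kappa>. T \<kappa> \<partial>L) = ennreal (?E * (\<Sum>j. \<xi> (j + n)))" .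
  have nP: "emeasure L {\<kappa>. u \<kappa> i \<le> \<delta>} = ennreal (measure std_normal_distribution {x. \<xi> i * exp (\<psi> x) \<le> \<delta>})" for i
  proof -
    have "{x \<in> space borel. \<xi> i * exp (\<psi> x) \<le> \<delta>} \<in> sets borel" by measurable
    then have A: "{x. \<xi> i * exp (\<psi> x) \<le> \<delta>} \<in> sets borel" by simp
    have "emeasure L {\<kappa>. u \<kappa> i \<le> \<delta>} = emeasure (distr L borel (\<lambda>\<kappa>. \<kappa> i)) {x. \<xi> i * exp (\<psi> x) \<le> \<delta>}"
      using A by (subst emeasure_distr) (auto simp: spL u_def vimage_def)
    then show ?thesis by (simp add: marg N.emeasure_eq_measure)
  qed
  have tail0: "0 \<le> (\<Sum>j. \<xi> (j + n))"
    using \<xi> \<xi>0 by (intro suminf_nonneg summable_ignore_initial_segment) (auto simp: mass_partitions_def)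
  have "ennreal \<bar>?I1 - ?I2\<bar> = ennreal \<bar>\<integral>\<kappa>. F1 \<kappa> - F2 \<kappa> \<partial>L\<bar>"
    by (simp only: Bochner_Integration.integral_diff[OF i12]) (simp add: F1_def[abs_def] F2_def[abs_def])
  also have "\<dots> \<le> (\<integral>\<^sup>+\<kappa>. ennreal \<bar>F1 \<kappa> - F2 \<kappa>\<bar> \<partial>L)"
    using integral_norm_bound_ennreal[of L "\<lambda>\<kappa>. F1 \<kappa> - F2 \<kappa>"] i12 by simp
  also have "\<dots> \<le> (\<integral>\<^sup>+\<kappa>. ?R \<kappa> \<partial>L)" by (intro nn_integral_mono pw)
  also have "\<dots> = ennreal (real m * real k * e) + (\<Sum>i<m. emeasure L {\<kappa>. u \<kappa> i \<le> \<delta>})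
      + ennreal (1 / (\<delta> * e)) * (\<integral>\<^sup>+\<kappa>. T \<kappa> \<partial>L)"
  proof -
    have [measurable]: "T \<in> borel_measurable L" unfolding T_def by measurable
    show ?thesis
      by (simp add: nn_integral_add nn_integral_sum nn_integral_cmult L.emeasure_space_1 nn_integral_indicator)
  qed
  also have "\<dots> = ennreal (real m * real k * e + ?P + ?E * (\<Sum>j. \<xi> (j + n)) / (\<delta> * e))"
    using pos E0 tail0 by (simp add: nP nT sum_ennreal ennreal_mult[symmetric] ennreal_plus[symmetric] sum_nonneg
        del: ennreal_plus)
  finally show ?thesis
    using pos E0 tail0 by (subst (asm) ennreal_le_iff) (auto intro!: add_nonneg_nonneg sum_nonneg)
qed

lemma std_normal_small_weight_tendsto:
  assumes [measurable]: "\<psi> \<in> borel_measurable borel" and "c > 0"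
  shows "(\<lambda>k. measure std_normal_distribution {x. c * exp (\<psi> x) \<le> 1 / real (Suc k)}) \<longlonglongrightarrow> 0"
proof -
  interpret prob_space std_normal_distribution by simp
  let ?A = "\<lambda>k. {x. c * exp (\<psi> x) \<le> 1 / real (Suc k)}"
  have "{x \<in> space borel. c * exp (\<psi> x) \<le> 1 / real (Suc k)} \<in> sets borel" for k by measurable
  then have A: "?A k \<in> sets borel" for k by simp
  have "(\<lambda>k. measure std_normal_distribution (?A k)) \<longlonglongrightarrow> measure std_normal_distribution (\<Inter>k. ?A k)"
  proof (rule finite_Lim_measure_decseq)
    show "range ?A \<subseteq> sets std_normal_distribution" using A by auto
    have "1 / real (Suc k') \<le> 1 / real (Suc k)" if "k \<le> k'" for k k' using that by (simp add: frac_le)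
    then show "decseq ?A" unfolding decseq_def using order_trans by blast
  qed
  moreover have "(\<Inter>k. ?A k) = {}"
  proof -
    have "\<exists>k. \<not> c * exp (\<psi> x) \<le> 1 / real (Suc k)" for x
      using nat_approx_posE[of "c * exp (\<psi> x)"] \<open>c > 0\<close> by (metis mult_pos_pos exp_gt_zero not_le)
    then show ?thesis by blast
  qed
  ultimately show ?thesis by simp
qed

text \<open>The point is that one \<open>n\<close> serves all \<open>L\<close>. The three error
  terms are made small by choosing \<open>e\<close>, then \<open>\<delta>\<close>, then
  \<open>n\<close>. The choice of \<open>\<delta>\<close> requires positive masses; if instead some
  mass vanishes, so do all later ones, and cutting there changes nothing.\<close>

lemma truncation_error_small:
  assumes \<psi>: "\<psi> \<in> borel_measurable borel" "integrable lborel (\<lambda>z. std_normal_density z * exp (\<psi> z))"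
    and s: "(\<xi>, Q) \<in> space overlap_space" and B: "\<And>i j. B i j \<in> sets borel" and "\<epsilon> > 0"
  shows "\<exists>n. \<forall>L. prob_space L \<longrightarrow> sets L = sets field_space \<longrightarrow>
      (\<forall>i. distr L borel (\<lambda>\<kappa>. \<kappa> i) = std_normal_distribution) \<longrightarrow>
      \<bar>(\<integral>\<kappa>. overlap_test k a B m (evolve \<psi> \<kappa> (\<xi>, Q)) \<partial>L)
        - (\<integral>\<kappa>. overlap_test k a B m (evolve \<psi> \<kappa> (truncate n \<xi>, Q)) \<partial>L)\<bar> < \<epsilon>"
proof (cases "\<exists>i. \<xi> i = 0")
  case True
  then obtain i where i: "\<xi> i = 0" by auto
  have "truncate i \<xi> = \<xi>"
  proof
    fix j
    have "\<xi> j \<le> 0" "0 \<le> \<xi> j" if "i \<le> j"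
      using s i that by (auto simp: space_overlap_space mass_partitions_def decseq_def) (metis)
    then show "truncate i \<xi> j = \<xi> j" by (auto simp: truncate_def)
  qed
  then show ?thesis using \<open>\<epsilon> > 0\<close> by (intro exI[of _ i]) simp
next
  case False
  have \<xi>: "\<xi> \<in> mass_partitions" using s by (simp add: space_overlap_space)
  then have \<xi>0: "0 < \<xi> i" for i using False by (auto simp: mass_partitions_def less_le)
  \<comment> \<open>The \<open>+ 1\<close> avoids a zero denominator when \<open>m\<close> or
    \<open>k\<close> is 0 and makes the estimate strict; the minimum with 1 meets the condition
    \<open>e \<le> 1\<close> of the error bound.\<close>
  define e where "e = min 1 (\<epsilon> / (3 * (real m * real k + 1)))"
  have mk: "0 \<le> real m * real k" by simp
  have "0 < 3 * (real m * real k + 1)" by (intro mult_pos_pos add_nonneg_pos mk) auto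
  then have "0 < \<epsilon> / (3 * (real m * real k + 1))"
    using \<open>\<epsilon> > 0\<close> by (intro divide_pos_pos)
  then have e: "0 < e" "e \<le> 1" unfolding e_def by linarith+
  have "real m * real k * e < (real m * real k + 1) * e" using e by simp
  also have "\<dots> \<le> (real m * real k + 1) * (\<epsilon> / (3 * (real m * real k + 1)))"
    using mk by (intro mult_left_mono) (auto simp: e_def)
  also have "\<dots> = \<epsilon> / 3" using mk by (simp add: field_simps add_nonneg_eq_0_iff)
  finally have e3: "real m * real k * e < \<epsilon> / 3" .
  have "(\<lambda>l. \<Sum>i<m. measure std_normal_distribution {x. \<xi> i * exp (\<psi> x) \<le> 1 / real (Suc l)}) \<longlonglongrightarrow> 0"
    by (intro tendsto_null_sum std_normal_small_weight_tendsto \<psi> \<xi>0)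
  then have "\<forall>\<^sub>F l in sequentially. (\<Sum>i<m. measure std_normal_distribution {x. \<xi> i * exp (\<psi> x) \<le> 1 / real (Suc l)}) < \<epsilon> / 3"
    by (rule order_tendstoD) (use \<open>\<epsilon> > 0\<close> in simp)
  then obtain l where l: "(\<Sum>i<m. measure std_normal_distribution {x. \<xi> i * exp (\<psi> x) \<le> 1 / real (Suc l)}) < \<epsilon> / 3"
    by (auto simp: eventually_sequentially)
  define \<delta> where "\<delta> = 1 / real (Suc l)"
  have \<delta>: "\<delta> > 0" by (simp add: \<delta>_def)
  let ?E = "\<integral>z. std_normal_density z * exp (\<psi> z) \<partial>lborel"
  \<comment> \<open>With \<open>\<delta>\<close> and \<open>e\<close> already fixed, the tail of the
    masses outweighs the factor \<open>1 / (\<delta> * e)\<close>.\<close>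
  have "(\<lambda>n. \<Sum>j. \<xi> (j + n)) \<longlonglongrightarrow> 0"
    using \<xi> by (intro suminf_exist_split2) (simp add: mass_partitions_def)
  then have "(\<lambda>n. ?E * (\<Sum>j. \<xi> (j + n)) / (\<delta> * e)) \<longlonglongrightarrow> ?E * 0 / (\<delta> * e)"
    using \<delta> e by (intro tendsto_intros) auto
  then have "\<forall>\<^sub>F n in sequentially. ?E * (\<Sum>j. \<xi> (j + n)) / (\<delta> * e) < \<epsilon> / 3"
    by (rule order_tendstoD) (use \<open>\<epsilon> > 0\<close> in simp)
  then obtain n where n: "?E * (\<Sum>j. \<xi> (j + n)) / (\<delta> * e) < \<epsilon> / 3"
    by (auto simp: eventually_sequentially)
  show ?thesis
  proof (intro exI[of _ n] allI impI)
    fix L :: "(nat \<Rightarrow> real) measure"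
    assume L: "prob_space L" "sets L = sets field_space" "\<forall>i. distr L borel (\<lambda>\<kappa>. \<kappa> i) = std_normal_distribution"
    have "\<bar>(\<integral>\<kappa>. overlap_test k a B m (evolve \<psi> \<kappa> (\<xi>, Q)) \<partial>L)
        - (\<integral>\<kappa>. overlap_test k a B m (evolve \<psi> \<kappa> (truncate n \<xi>, Q)) \<partial>L)\<bar>
      \<le> real m * real k * e + (\<Sum>i<m. measure std_normal_distribution {x. \<xi> i * exp (\<psi> x) \<le> \<delta>})
      + ?E * (\<Sum>j. \<xi> (j + n)) / (\<delta> * e)"
      by (rule truncation_error_bound[OF \<psi> L(1,2) spec[OF L(3)] s B \<delta> e])
    then show "\<bar>(\<integral>\<kappa>. overlap_test k a B m (evolve \<psi> \<kappa> (\<xi>, Q)) \<partial>L)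
        - (\<integral>\<kappa>. overlap_test k a B m (evolve \<psi> \<kappa> (truncate n \<xi>, Q)) \<partial>L)\<bar> < \<epsilon>"
      using e3 l n unfolding \<delta>_def[symmetric] by linarith
  qed
qed

section \<open>Convergence to the free evolution\<close>

lemma gaussian_field_marginal:
  assumes "centered_gaussian_field C L" "C i i = 1"
  shows "distr L borel (\<lambda>\<kappa>. \<kappa> i) = std_normal_distribution"
proof -
  have "distr L borel (\<lambda>\<kappa>. \<Sum>j\<in>{i}. 1 * \<kappa> j) = centered_normal (\<Sum>j\<in>{i}. \<Sum>l\<in>{i}. 1 * 1 * C j l)"
    by (rule assms(1)[unfolded centered_gaussian_field_def, THEN conjunct2, rule_format]) simp
  then show ?thesis using assms(2) by (simp add: centered_normal_def)
qed

lemma sets_free_field: "sets free_field = sets field_space"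
  unfolding free_field_def by (intro sets_PiM_cong) auto

lemma prob_space_free_field: "prob_space free_field"
  unfolding free_field_def by (rule prob_space_PiM) simp

lemma free_field_marginal: "distr free_field borel (\<lambda>\<kappa>. \<kappa> i) = std_normal_distribution"
proof -
  interpret product_prob_space "\<lambda>_. std_normal_distribution" "UNIV :: nat set"
    by (simp add: product_prob_space_def product_prob_space_axioms_def product_sigma_finite_def
        prob_space_imp_sigma_finite)
  have "distr free_field borel (\<lambda>\<kappa>. \<kappa> i) = distr free_field std_normal_distribution (\<lambda>\<kappa>. \<kappa> i)"
    by (rule distr_cong) auto
  then show ?thesis unfolding free_field_def using PiM_component[of i] by simp
qed

text \<open>Positive definiteness on the sum and on the difference of the unit vectors at
  \<open>i\<close> and \<open>j\<close> gives \<open>2 + 2 * Q i j > 0\<close> and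
  \<open>2 - 2 * Q i j > 0\<close>.\<close>

lemma pd_overlap_less_1:
  assumes pd: "pd_matrix Q" and Q: "Q \<in> overlap_matrices" and "i \<noteq> j"
  shows "\<bar>Q i j\<bar> < 1"
proof -
  have sym: "Q j i = Q i j" and diag: "Q i i = 1" "Q j j = 1"
    using Q by (auto simp: overlap_matrices_def psd_matrix_def)
  have *: "0 < (\<Sum>x\<in>{i, j}. \<Sum>y\<in>{i, j}. t x * t y * Q x y)" if "t i \<noteq> 0" for t
    by (rule pd[unfolded pd_matrix_def, THEN conjunct2, rule_format]) (use that in auto)
  have "0 < 2 + 2 * Q i j" using *[of "\<lambda>_. 1"] \<open>i \<noteq> j\<close> sym diag by simp
  moreover have "0 < 2 - 2 * Q i j" using *[of "\<lambda>x. if x = i then 1 else -1"] \<open>i \<noteq> j\<close> sym diag by simp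
  ultimately show ?thesis by linarith
qed

text \<open>Three errors of \<open>\<epsilon> / 3\<close>: truncation under \<open>L k\<close>,
  truncation under the free field with the same \<open>n\<close>, and the convergence of the
  truncated integrals by \<open>gaussian_cylinder_tendsto\<close>.\<close>

lemma evolve_gaussian_tendsto:
  assumes \<psi>: "\<psi> \<in> borel_measurable borel" "integrable lborel (\<lambda>z. std_normal_density z * exp (\<psi> z))"
    and s: "s \<in> space overlap_space" and pd: "pd_matrix (snd s)"
    and r: "filterlim r at_top sequentially"
    and L: "\<And>k. prob_space (L k)" "\<And>k. centered_gaussian_field (hadamard_power (snd s) (r k)) (L k)"
    and B: "\<And>i j. B i j \<in> sets borel"
  shows "(\<lambda>k. \<integral>\<kappa>. overlap_test l a B m (evolve \<psi> \<kappa> s) \<partial>L k)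
    \<longlonglongrightarrow> (\<integral>\<kappa>. overlap_test l a B m (evolve \<psi> \<kappa> s) \<partial>free_field)"
proof (rule LIMSEQ_I)
  fix \<epsilon> :: real assume \<epsilon>: "\<epsilon> > 0"
  obtain \<xi> Q where sQ: "s = (\<xi>, Q)" by (cases s)
  have \<xi>: "\<xi> \<in> mass_partitions" and Q: "Q \<in> overlap_matrices" using s by (auto simp: sQ space_overlap_space)
  let ?F = "overlap_test l a B m"
  have \<epsilon>3: "0 < \<epsilon> / 3" using \<epsilon> by simp
  obtain n where n: "\<forall>L. prob_space L \<longrightarrow> sets L = sets field_space \<longrightarrow>
      (\<forall>i. distr L borel (\<lambda>\<kappa>. \<kappa> i) = std_normal_distribution) \<longrightarrow>
      \<bar>(\<integral>\<kappa>. ?F (evolve \<psi> \<kappa> s) \<partial>L) - (\<integral>\<kappa>. ?F (evolve \<psi> \<kappa> (truncate n \<xi>, Q)) \<partial>L)\<bar> < \<epsilon> / 3"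
    using truncation_error_small[where B = B and k = l and a = a and m = m, OF \<psi> s[unfolded sQ] B \<epsilon>3]
    unfolding sQ by (rule exE)
  let ?H = "\<lambda>\<kappa>. ?F (evolve \<psi> \<kappa> (truncate n \<xi>, Q))"
  let ?C = "\<lambda>k. hadamard_power Q (r k)"
  have s': "(truncate n \<xi>, Q) \<in> space overlap_space"
    using truncate_mass_partition[OF \<xi>] Q by (simp add: space_overlap_space)
  have diag: "?C k i i = 1" for k i using Q by (simp add: hadamard_power_def overlap_matrices_def)
  have "(\<lambda>k. \<integral>\<kappa>. ?H \<kappa> \<partial>L k) \<longlonglongrightarrow> (\<integral>\<kappa>. ?H \<kappa> \<partial>free_field)"
  proof (rule gaussian_cylinder_tendsto[where C = ?C and n = n and B = 1])
    show "?C k i j = ?C k j i" for k i j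
      using Q by (simp add: hadamard_power_def overlap_matrices_def psd_matrix_def)
    show "(\<lambda>k. ?C k i j) \<longlonglongrightarrow> 0" if "i \<noteq> j" for i j
    proof -
      have "norm (Q i j) < 1" using pd_overlap_less_1[OF _ Q that] pd by (simp add: sQ)
      then show ?thesis unfolding hadamard_power_def
        by (rule filterlim_compose[OF LIMSEQ_power_zero r])
    qed
    have "(\<lambda>\<kappa>. evolve \<psi> \<kappa> (truncate n \<xi>, Q)) \<in> field_space \<rightarrow>\<^sub>M overlap_space"
      using measurable_compose[OF measurable_Pair1'[OF s'] measurable_evolve[OF \<psi>(1)]] by simp
    then show "?H \<in> borel_measurable field_space"
      by (rule measurable_compose[OF _ measurable_overlap_test[OF B]])
    show "?H x = ?H y" if "\<And>i. i < n \<Longrightarrow> x i = y i" for x y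
    proof -
      \<comment> \<open>Coordinates from \<open>n\<close> on are multiplied by mass 0, so the
        truncated evolution ignores them.\<close>
      have eq: "truncate n \<xi> j * exp (\<psi> (x j)) = truncate n \<xi> j * exp (\<psi> (y j))" for j
        using that by (simp add: truncate_def)
      show ?thesis by (simp add: evolve_def eq)
    qed
    show "\<bar>?H x\<bar> \<le> 1" for x using overlap_test_bounds by (simp add: abs_le_iff)
  qed (use L sQ diag in auto)
  then obtain K where K: "\<And>k. k \<ge> K \<Longrightarrow> \<bar>(\<integral>\<kappa>. ?H \<kappa> \<partial>L k) - (\<integral>\<kappa>. ?H \<kappa> \<partial>free_field)\<bar> < \<epsilon> / 3"
    using LIMSEQ_D[of _ _ "\<epsilon> / 3"] \<epsilon> by fastforce
  have "norm ((\<integral>\<kappa>. ?F (evolve \<psi> \<kappa> s) \<partial>L k) - (\<integral>\<kappa>. ?F (evolve \<psi> \<kappa> s) \<partial>free_field)) < \<epsilon>" if "k \<ge> K" for k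
  proof -
    have Lk: "centered_gaussian_field (?C k) (L k)" using L(2)[of k] by (simp add: sQ)
    have "\<bar>(\<integral>\<kappa>. ?F (evolve \<psi> \<kappa> s) \<partial>L k) - (\<integral>\<kappa>. ?H \<kappa> \<partial>L k)\<bar> < \<epsilon> / 3"
      using Lk by (intro n[rule_format] L gaussian_field_marginal[OF Lk diag]) (simp add: centered_gaussian_field_def)
    moreover have "\<bar>(\<integral>\<kappa>. ?F (evolve \<psi> \<kappa> s) \<partial>free_field) - (\<integral>\<kappa>. ?H \<kappa> \<partial>free_field)\<bar> < \<epsilon> / 3"
      by (intro n[rule_format] prob_space_free_field sets_free_field free_field_marginal)
    ultimately show ?thesis using K[OF that] unfolding real_norm_def by linarith
  qed
  then show "\<exists>K. \<forall>k\<ge>K. norm ((\<integral>\<kappa>. ?F (evolve \<psi> \<kappa> s) \<partial>L k) - (\<integral>\<kappa>. ?F (evolve \<psi> \<kappa> s) \<partial>free_field)) < \<epsilon>"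
    by blast
qed

section \<open>The evolved law as a mixture over a kernel\<close>

lemma evolved_kernel_measurable:
  assumes \<psi>: "\<psi> \<in> borel_measurable borel" and K: "K \<in> overlap_space \<rightarrow>\<^sub>M prob_algebra field_space"
  shows "(\<lambda>s. distr (K s) overlap_space (\<lambda>\<kappa>. evolve \<psi> \<kappa> s)) \<in> overlap_space \<rightarrow>\<^sub>M prob_algebra overlap_space"
proof (rule measurable_prob_algebraI)
  show "(\<lambda>s. distr (K s) overlap_space (\<lambda>\<kappa>. evolve \<psi> \<kappa> s)) \<in> overlap_space \<rightarrow>\<^sub>M subprob_algebra overlap_space"
    by (rule measurable_distr2[OF measurable_evolve[OF \<psi>] measurable_prob_algebraD[OF K]])
  fix s assume s: "s \<in> space overlap_space"
  have Ks: "prob_space (K s)" "sets (K s) = sets field_space"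
    using measurable_space[OF K s] by (auto simp: space_prob_algebra)
  have "(\<lambda>\<kappa>. evolve \<psi> \<kappa> s) \<in> field_space \<rightarrow>\<^sub>M overlap_space"
    using measurable_compose[OF measurable_Pair1'[OF s] measurable_evolve[OF \<psi>]] by simp
  then show "prob_space (distr (K s) overlap_space (\<lambda>\<kappa>. evolve \<psi> \<kappa> s))"
    using Ks by (intro prob_space.prob_space_distr) (auto simp: measurable_cong_sets[OF Ks(2) refl])
qed

text \<open>The first fact disintegrates the evolved law, so that limits can be taken for fixed
  \<open>\<omega>\<close>; the other two supply measurability and domination for the outer
  limit.\<close>

lemma integral_evolved_law:
  fixes F :: "overlap_structure \<Rightarrow> real"
  assumes \<psi>: "\<psi> \<in> borel_measurable borel" and K: "K \<in> overlap_space \<rightarrow>\<^sub>M prob_algebra field_space"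
    and M: "prob_space M" and X [measurable]: "X \<in> M \<rightarrow>\<^sub>M overlap_space"
    and F [measurable]: "F \<in> borel_measurable overlap_space" and b: "\<And>s. 0 \<le> F s" "\<And>s. F s \<le> 1"
  shows "(\<integral>s. F s \<partial>evolved_law \<psi> K (distr M overlap_space X))
      = (\<integral>\<omega>. (\<integral>\<kappa>. F (evolve \<psi> \<kappa> (X \<omega>)) \<partial>K (X \<omega>)) \<partial>M)"
    and "(\<lambda>\<omega>. \<integral>\<kappa>. F (evolve \<psi> \<kappa> (X \<omega>)) \<partial>K (X \<omega>)) \<in> borel_measurable M"
    and "\<And>\<omega>. \<omega> \<in> space M \<Longrightarrow> norm (\<integral>\<kappa>. F (evolve \<psi> \<kappa> (X \<omega>)) \<partial>K (X \<omega>)) \<le> 1"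
proof -
  interpret M: prob_space M by fact
  let ?D = "\<lambda>s. distr (K s) overlap_space (\<lambda>\<kappa>. evolve \<psi> \<kappa> s)"
  have Dp: "?D \<in> overlap_space \<rightarrow>\<^sub>M prob_algebra overlap_space" by (rule evolved_kernel_measurable[OF \<psi> K])
  have D [measurable]: "?D \<in> overlap_space \<rightarrow>\<^sub>M subprob_algebra overlap_space"
    using Dp by (rule measurable_prob_algebraD)
  have em: "(\<lambda>\<kappa>. evolve \<psi> \<kappa> s) \<in> K s \<rightarrow>\<^sub>M overlap_space" if s: "s \<in> space overlap_space" for s
  proof -
    have "sets (K s) = sets field_space"
      using measurable_space[OF K s] by (auto simp: space_prob_algebra)
    then show ?thesis
      using measurable_compose[OF measurable_Pair1'[OF s] measurable_evolve[OF \<psi>]]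
      by (simp add: measurable_cong_sets[of "K s" field_space])
  qed
  define J where "J s = (\<integral>\<kappa>. F (evolve \<psi> \<kappa> s) \<partial>K s)" for s
  have JD: "J s = (\<integral>x. F x \<partial>?D s)" if s: "s \<in> space overlap_space" for s
    unfolding J_def by (subst integral_distr[OF em[OF s] F]) simp
  have Jm [measurable]: "J \<in> borel_measurable overlap_space"
  proof (subst measurable_cong[OF JD])
    show "(\<lambda>s. \<integral>x. F x \<partial>?D s) \<in> borel_measurable overlap_space"
      by (rule measurable_compose[OF D integral_measurable_subprob_algebra[OF F]])
  qed
  have nn: "(\<integral>\<^sup>+x. F x \<partial>?D s) = ennreal (J s)" "0 \<le> J s" "J s \<le> 1" if s: "s \<in> space overlap_space" for s
  proof -
    have ps: "prob_space (?D s)" using measurable_space[OF Dp s] by (simp add: space_prob_algebra)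
    then interpret D: prob_space "?D s" .
    have i: "integrable (?D s) F"
      using b by (intro D.integrable_const_bound[of _ 1]) auto
    show "(\<integral>\<^sup>+x. F x \<partial>?D s) = ennreal (J s)"
      unfolding JD[OF s] using i b by (intro nn_integral_eq_integral) auto
    show "0 \<le> J s" unfolding J_def using b by (intro integral_nonneg_AE) auto
    show "J s \<le> 1" unfolding JD[OF s] using i b by (intro D.integral_le_const) auto
  qed
  have XM: "X \<omega> \<in> space overlap_space" if "\<omega> \<in> space M" for \<omega> using measurable_space[OF X that] .
  show "(\<lambda>\<omega>. \<integral>\<kappa>. F (evolve \<psi> \<kappa> (X \<omega>)) \<partial>K (X \<omega>)) \<in> borel_measurable M"
    unfolding J_def[symmetric] by measurable
  show "norm (\<integral>\<kappa>. F (evolve \<psi> \<kappa> (X \<omega>)) \<partial>K (X \<omega>)) \<le> 1" if "\<omega> \<in> space M" for \<omega>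
    unfolding J_def[symmetric] using nn[OF XM[OF that]] by simp
  let ?\<mu> = "distr M overlap_space X"
  have ev: "evolved_law \<psi> K ?\<mu> = ?\<mu> \<bind> ?D" by (simp add: evolved_law_def)
  have ne: "space ?\<mu> \<noteq> {}" using M.not_empty XM by auto
  have sets_ev: "sets (?\<mu> \<bind> ?D) = sets overlap_space" using ne by (intro sets_bind[where N = overlap_space]) auto
  have "(\<integral>s. F s \<partial>(?\<mu> \<bind> ?D)) = enn2real (\<integral>\<^sup>+s. F s \<partial>(?\<mu> \<bind> ?D))"
    using b by (intro integral_eq_nn_integral) (auto simp: measurable_cong_sets[OF sets_ev refl])
  also have "(\<integral>\<^sup>+s. F s \<partial>(?\<mu> \<bind> ?D)) = (\<integral>\<^sup>+s. (\<integral>\<^sup>+x. F x \<partial>?D s) \<partial>?\<mu>)"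
    by (rule nn_integral_bind[where B = overlap_space]) auto
  also have "\<dots> = (\<integral>\<^sup>+s. J s \<partial>?\<mu>)" by (intro nn_integral_cong) (simp add: nn)
  also have "\<dots> = (\<integral>\<^sup>+\<omega>. J (X \<omega>) \<partial>M)" by (subst nn_integral_distr) auto
  also have "enn2real \<dots> = (\<integral>\<omega>. J (X \<omega>) \<partial>M)"
    by (intro integral_eq_nn_integral[symmetric]) (auto intro!: AE_I2 nn XM)
  finally show "(\<integral>s. F s \<partial>evolved_law \<psi> K ?\<mu>) = (\<integral>\<omega>. (\<integral>\<kappa>. F (evolve \<psi> \<kappa> (X \<omega>)) \<partial>K (X \<omega>)) \<partial>M)"
    by (simp add: ev J_def)
qed

lemma prob_space_evolved_law:
  assumes \<psi>: "\<psi> \<in> borel_measurable borel" and K: "K \<in> overlap_space \<rightarrow>\<^sub>M prob_algebra field_space"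
    and \<mu>: "prob_space \<mu>" "sets \<mu> = sets overlap_space"
  shows "prob_space (evolved_law \<psi> K \<mu>)" "sets (evolved_law \<psi> K \<mu>) = sets overlap_space"
proof -
  let ?D = "\<lambda>s. distr (K s) overlap_space (\<lambda>\<kappa>. evolve \<psi> \<kappa> s)"
  have D: "?D \<in> \<mu> \<rightarrow>\<^sub>M prob_algebra overlap_space"
    using evolved_kernel_measurable[OF \<psi> K] by (simp add: measurable_cong_sets[OF \<mu>(2) refl])
  then have D': "?D \<in> \<mu> \<rightarrow>\<^sub>M subprob_algebra overlap_space" by (rule measurable_prob_algebraD)
  have "AE s in \<mu>. prob_space (?D s)"
    using measurable_space[OF D] by (intro AE_I2) (simp add: space_prob_algebra)
  then show "prob_space (evolved_law \<psi> K \<mu>)"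
    unfolding evolved_law_def using D' by (rule prob_space.prob_space_bind[OF \<mu>(1)])
  show "sets (evolved_law \<psi> K \<mu>) = sets overlap_space"
    unfolding evolved_law_def using measurable_space[OF D'] prob_space.not_empty[OF \<mu>(1)]
    by (intro sets_bind) (simp_all add: space_subprob_algebra)
qed

section \<open>A generating system of cylinders, and laws determined by test functions\<close>

definition overlap_cylinder ::
  "(nat \<Rightarrow> real) \<Rightarrow> (nat \<Rightarrow> nat \<Rightarrow> real set) \<Rightarrow> nat \<Rightarrow> overlap_structure set" where
  "overlap_cylinder a B m = {s \<in> space overlap_space.
     (\<forall>i<m. a i < fst s i) \<and> (\<forall>i<m. \<forall>j<m. snd s i j \<in> B i j)}"

definition overlap_cylinders :: "overlap_structure set set" where
  "overlap_cylinders = {overlap_cylinder a B m |a B m. \<forall>i j. B i j \<in> sets borel}"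

lemma overlap_cylinderI:
  "(\<And>i j. B i j \<in> sets borel) \<Longrightarrow> S = overlap_cylinder a B m \<Longrightarrow> S \<in> overlap_cylinders"
  by (auto simp: overlap_cylinders_def)

lemma sets_overlap_cylinder:
  assumes [measurable]: "\<And>i j. B i j \<in> sets borel"
  shows "overlap_cylinder a B m \<in> sets overlap_space"
  unfolding overlap_cylinder_def by measurable

lemma Int_stable_overlap_cylinders: "Int_stable overlap_cylinders"
proof (rule Int_stableI)
  fix S S' assume "S \<in> overlap_cylinders" "S' \<in> overlap_cylinders"
  then obtain a B m a' B' m' where S: "S = overlap_cylinder a B m" "\<And>i j. B i j \<in> sets borel"
    and S': "S' = overlap_cylinder a' B' m'" "\<And>i j. B' i j \<in> sets borel"
    by (auto simp: overlap_cylinders_def)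
  \<comment> \<open>Both cylinders are brought to a common size by vacuous constraints;
    \<open>- 1\<close> is one because weights are nonnegative.\<close>
  define a1 where "a1 a m i = (if i < m then a i else - 1)" for a :: "nat \<Rightarrow> real" and m i :: nat
  define B1 where "B1 B m i j = (if i < m \<and> j < m then B i j else UNIV)"
    for B :: "nat \<Rightarrow> nat \<Rightarrow> real set" and m i j :: nat
  have ext: "overlap_cylinder a B m = overlap_cylinder (a1 a m) (B1 B m) n" if "m \<le> n" for a B m n
  proof -
    have pos: "0 \<le> fst s i" if "s \<in> space overlap_space" for s i
      using that by (auto simp: space_overlap_space mass_partitions_def)
    show ?thesis unfolding overlap_cylinder_def
    proof (rule Collect_cong, rule conj_cong[OF refl])
      fix s assume "s \<in> space overlap_space"
      then have "- 1 < fst s i" for i using pos[of s i] by linarith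
      then show "((\<forall>i<m. a i < fst s i) \<and> (\<forall>i<m. \<forall>j<m. snd s i j \<in> B i j)) \<longleftrightarrow>
        ((\<forall>i<n. a1 a m i < fst s i) \<and> (\<forall>i<n. \<forall>j<n. snd s i j \<in> B1 B m i j))"
        using that by (auto simp: a1_def B1_def)
    qed
  qed
  let ?n = "max m m'"
  have "S \<inter> S' = overlap_cylinder (\<lambda>i. max (a1 a m i) (a1 a' m' i)) (\<lambda>i j. B1 B m i j \<inter> B1 B' m' i j) ?n"
    unfolding S S' ext[of m ?n a B, OF max.cobounded1] ext[of m' ?n a' B', OF max.cobounded2]
    unfolding overlap_cylinder_def by auto
  then show "S \<inter> S' \<in> overlap_cylinders"
    by (rule overlap_cylinderI[rotated]) (use S S' in \<open>auto simp: B1_def\<close>)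
qed

text \<open>For the inclusion from left to right, the identity is shown to be measurable from the
  generated sigma-algebra, which by \<open>measurable_overlap_spaceI\<close> is a matter of single
  entries.\<close>

lemma sets_overlap_space_cylinders:
  "sets overlap_space = sigma_sets (space overlap_space) overlap_cylinders"
proof
  have sub: "overlap_cylinders \<subseteq> sets overlap_space"
    using sets_overlap_cylinder by (auto simp: overlap_cylinders_def)
  then show "sigma_sets (space overlap_space) overlap_cylinders \<subseteq> sets overlap_space"
    by (rule sets.sigma_sets_subset)
  let ?S = "sigma (space overlap_space) overlap_cylinders"
  have Pow: "overlap_cylinders \<subseteq> Pow (space overlap_space)" using sub sets.space_closed by blast
  then have sp: "space ?S = space overlap_space" and st: "sets ?S = sigma_sets (space overlap_space) overlap_cylinders"
    by (auto simp: space_measure_of sets_measure_of)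
  have pos: "- 1 < fst s i" if "s \<in> space overlap_space" for s i
  proof -
    have "0 \<le> fst s i" using that by (auto simp: space_overlap_space mass_partitions_def)
    then show ?thesis by linarith
  qed
  have "(\<lambda>s. s) \<in> ?S \<rightarrow>\<^sub>M overlap_space"
  proof (rule measurable_overlap_spaceI)
    fix i
    show "(\<lambda>s. fst s i) \<in> borel_measurable ?S"
    proof (rule borel_measurableI_greater)
      fix c :: real
      have "{s \<in> space overlap_space. c < fst s i}
        = overlap_cylinder (\<lambda>j. if j = i then c else - 1) (\<lambda>_ _. UNIV) (Suc i)"
        using pos by (auto simp: overlap_cylinder_def)
      then have "{s \<in> space overlap_space. c < fst s i} \<in> overlap_cylinders"
        by (rule overlap_cylinderI[rotated]) simp
      then show "{s \<in> space ?S. c < fst s i} \<in> sets ?S" unfolding sp st by (rule sigma_sets.Basic)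
    qed
  next
    fix i j
    show "(\<lambda>s. snd s i j) \<in> borel_measurable ?S"
    proof (rule borel_measurableI_greater)
      fix c :: real
      have "{s \<in> space overlap_space. c < snd s i j}
        = overlap_cylinder (\<lambda>_. - 1) (\<lambda>i' j'. if i' = i \<and> j' = j then {c<..} else UNIV) (Suc (max i j))"
        using pos by (auto simp: overlap_cylinder_def less_Suc_eq_le)
      then have "{s \<in> space overlap_space. c < snd s i j} \<in> overlap_cylinders"
        by (rule overlap_cylinderI[rotated]) simp
      then show "{s \<in> space ?S. c < snd s i j} \<in> sets ?S" unfolding sp st by (rule sigma_sets.Basic)
    qed
  qed (simp add: sp)
  show "sets overlap_space \<subseteq> sigma_sets (space overlap_space) overlap_cylinders"
  proof
    fix A assume A: "A \<in> sets overlap_space"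
    then have "(\<lambda>s. s) -` A \<inter> space ?S \<in> sets ?S"
      using \<open>(\<lambda>s. s) \<in> ?S \<rightarrow>\<^sub>M overlap_space\<close> by (rule measurable_sets[rotated])
    moreover have "(\<lambda>s. s) -` A \<inter> space ?S = A" using sets.sets_into_space[OF A] by (auto simp: sp)
    ultimately show "A \<in> sigma_sets (space overlap_space) overlap_cylinders" by (simp only: st)
  qed
qed

text \<open>As \<open>k\<close> grows the ramps increase to indicators of open half-lines, so
  equality of the test integrals passes to the cylinders, an intersection-stable generator.\<close>

lemma overlap_law_eqI:
  assumes \<mu>: "prob_space \<mu>" "sets \<mu> = sets overlap_space" and \<nu>: "prob_space \<nu>" "sets \<nu> = sets overlap_space"
    and eq: "\<And>k a B m. (\<And>i j. B i j \<in> sets borel) \<Longrightarrow>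
      (\<integral>s. overlap_test k a B m s \<partial>\<mu>) = (\<integral>s. overlap_test k a B m s \<partial>\<nu>)"
  shows "\<mu> = \<nu>"
proof (rule measure_eqI_generator_eq[OF Int_stable_overlap_cylinders, of "space overlap_space"])
  show "overlap_cylinders \<subseteq> Pow (space overlap_space)" by (auto simp: overlap_cylinders_def overlap_cylinder_def)
  show "sets \<mu> = sigma_sets (space overlap_space) overlap_cylinders"
    "sets \<nu> = sigma_sets (space overlap_space) overlap_cylinders"
    by (simp_all add: \<mu> \<nu> sets_overlap_space_cylinders)
  \<comment> \<open>A cylinder of size 0 is the whole space.\<close>
  show "range (\<lambda>_::nat. space overlap_space) \<subseteq> overlap_cylinders"
    using overlap_cylinderI[of "\<lambda>_ _. UNIV" "space overlap_space" undefined 0] by (auto simp: overlap_cylinder_def)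
  show "emeasure \<mu> (space overlap_space) \<noteq> \<infinity>"
    using \<mu> finite_measure.emeasure_finite[OF prob_space.finite_measure] by simp
  fix S assume "S \<in> overlap_cylinders"
  then obtain a B m where S: "S = overlap_cylinder a B m" and B: "\<And>i j. B i j \<in> sets borel"
    by (auto simp: overlap_cylinders_def)
  have lim: "(\<lambda>k. \<integral>s. overlap_test k a B m s \<partial>P) \<longlonglongrightarrow> measure P S"
    if P: "prob_space P" and sP [measurable_cong]: "sets P = sets overlap_space" for P
  proof -
    interpret P: prob_space P by fact
    have spP: "space P = space overlap_space" using sP by (rule sets_eq_imp_space_eq)
    have "(\<lambda>k. \<integral>s. overlap_test k a B m s \<partial>P) \<longlonglongrightarrow> (\<integral>s. indicator S s \<partial>P)"
    proof (rule integral_dominated_convergence[where w = "\<lambda>_. 1"])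
      show "(\<lambda>s. indicator S s :: real) \<in> borel_measurable P"
        using sets_overlap_cylinder[OF B] by (simp add: S sP)
      show "overlap_test k a B m \<in> borel_measurable P" for k
        using measurable_overlap_test[OF B] by (simp add: measurable_cong_sets[OF sP refl])
      show "AE s in P. norm (overlap_test k a B m s) \<le> 1" for k
        by (simp add: overlap_test_bounds)
      show "AE s in P. (\<lambda>k. overlap_test k a B m s) \<longlonglongrightarrow> indicator S s"
      proof (rule AE_I2)
        fix s assume s: "s \<in> space P"
        have "(\<lambda>k. overlap_test k a B m s) \<longlonglongrightarrow>
          (\<Prod>i<m. indicator {a i<..} (fst s i)) * (\<Prod>i<m. \<Prod>j<m. indicator (B i j) (snd s i j))"
          unfolding overlap_test_def by (intro tendsto_intros ramp_tendsto)
        also have "(\<Prod>i<m. indicator {a i<..} (fst s i)) * (\<Prod>i<m. \<Prod>j<m. indicator (B i j) (snd s i j)) = (indicator S s :: real)"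
          using s by (auto simp: S overlap_cylinder_def spP indicator_def prod_zero_iff)
        finally show "(\<lambda>k. overlap_test k a B m s) \<longlonglongrightarrow> indicator S s" .
      qed
    qed simp
    then show ?thesis using sets_overlap_cylinder[OF B] sP by (simp add: S)
  qed
  have "measure \<mu> S = measure \<nu> S"
    using lim[OF \<mu>] lim[OF \<nu>] unfolding eq[OF B] by (rule LIMSEQ_unique)
  then show "emeasure \<mu> S = emeasure \<nu> S"
    using finite_measure.emeasure_eq_measure[OF prob_space.finite_measure] \<mu>(1) \<nu>(1) by metis
qed auto

theorem theorem1p10:
  fixes \<psi> :: "real \<Rightarrow> real"
    and M :: "'a measure"
    and X :: "'a \<Rightarrow> (nat \<Rightarrow> real) \<times> (nat \<Rightarrow> nat \<Rightarrow> real)"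
  assumes "admissible \<psi>"
    and "ROSt M X"
    and "robustly_quasi_stationary \<psi> M X"
  shows "freely_quasi_stationary \<psi> M X"
proof -
  have \<psi>: "\<psi> \<in> borel_measurable borel"
    and int: "integrable lborel (\<lambda>z. std_normal_density z * exp (\<psi> z))"
    using assms(1) unfolding admissible_def by (auto dest: spec[of _ 1])
  have M: "prob_space M" and X: "X \<in> M \<rightarrow>\<^sub>M overlap_space" and pd: "AE \<omega> in M. pd_matrix (snd (X \<omega>))"
    using assms(2) by (auto simp: ROSt_def)
  let ?\<mu> = "distr M overlap_space X"
  let ?R = "{r. quasi_stationary \<psi> r M X}"
  define r where "r = enumerate ?R"
  have inf: "infinite ?R" using assms(3) by (simp add: robustly_quasi_stationary_def)
  have r: "filterlim r at_top sequentially"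
    unfolding r_def using strict_mono_enumerate[OF inf] by (rule filterlim_subseq)
  have "quasi_stationary \<psi> (r k) M X" for k using enumerate_in_set[OF inf, of k] by (simp add: r_def)
  then obtain K where K: "\<And>k. gaussian_kernel (r k) M X (K k)" and qs: "\<And>k. evolved_law \<psi> (K k) ?\<mu> = ?\<mu>"
    unfolding quasi_stationary_def by metis
  have Km: "K k \<in> overlap_space \<rightarrow>\<^sub>M prob_algebra field_space" for k
    using K by (simp add: gaussian_kernel_def)
  \<comment> \<open>There are countably many powers, so one exceptional null set serves all of
    them.\<close>
  have KG: "AE \<omega> in M. \<forall>k. centered_gaussian_field (hadamard_power (snd (X \<omega>)) (r k)) (K k (X \<omega>))"
    using K by (simp add: gaussian_kernel_def AE_all_countable)
  have free: "(\<lambda>_. free_field) \<in> overlap_space \<rightarrow>\<^sub>M prob_algebra field_space"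
    by (rule measurable_const) (simp add: space_prob_algebra sets_free_field prob_space_free_field)
  have \<mu>: "prob_space ?\<mu>" "sets ?\<mu> = sets overlap_space"
    using M X by (auto intro: prob_space.prob_space_distr)
  have "evolved_law \<psi> (\<lambda>_. free_field) ?\<mu> = ?\<mu>"
  proof (rule overlap_law_eqI[OF prob_space_evolved_law[OF \<psi> free \<mu>] \<mu>])
    fix l a and B :: "nat \<Rightarrow> nat \<Rightarrow> real set" and m assume B: "\<And>i j. B i j \<in> sets borel"
    let ?F = "overlap_test l a B m"
    note law = integral_evolved_law[OF \<psi> _ M X measurable_overlap_test[OF B, where k = l and a = a and m = m]
        overlap_test_bounds]
    have "(\<lambda>k. \<integral>\<omega>. (\<integral>\<kappa>. ?F (evolve \<psi> \<kappa> (X \<omega>)) \<partial>K k (X \<omega>)) \<partial>M)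
      \<longlonglongrightarrow> (\<integral>\<omega>. (\<integral>\<kappa>. ?F (evolve \<psi> \<kappa> (X \<omega>)) \<partial>free_field) \<partial>M)"
    proof (rule integral_dominated_convergence[where w = "\<lambda>_. 1"])
      show "AE \<omega> in M. (\<lambda>k. \<integral>\<kappa>. ?F (evolve \<psi> \<kappa> (X \<omega>)) \<partial>K k (X \<omega>))
        \<longlonglongrightarrow> (\<integral>\<kappa>. ?F (evolve \<psi> \<kappa> (X \<omega>)) \<partial>free_field)"
        using pd KG AE_space
      proof eventually_elim
        case (elim \<omega>)
        have X\<omega>: "X \<omega> \<in> space overlap_space" using measurable_space[OF X] elim by simp
        show ?case
        proof (rule evolve_gaussian_tendsto[OF \<psi> int X\<omega> elim(1) r _ _ B])
          show "prob_space (K k (X \<omega>))" for k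
            using measurable_space[OF Km X\<omega>] by (simp add: space_prob_algebra)
        qed (use elim in simp)
      qed
      show "AE \<omega> in M. norm (\<integral>\<kappa>. ?F (evolve \<psi> \<kappa> (X \<omega>)) \<partial>K k (X \<omega>)) \<le> 1" for k
        by (rule AE_I2) (rule law(3)[OF Km])
      show "integrable M (\<lambda>_. 1 :: real)" using prob_space.finite_measure[OF M] by (simp add: finite_measure.integrable_const)
    qed (use law(2)[OF Km] law(2)[OF free] in auto)
    \<comment> \<open>By quasi-stationarity each term on the left is the integral against the
      original law, so the sequence is constant and equals its limit.\<close>
    then have "(\<lambda>k. \<integral>s. ?F s \<partial>?\<mu>) \<longlonglongrightarrow> (\<integral>s. ?F s \<partial>evolved_law \<psi> (\<lambda>_. free_field) ?\<mu>)"
      unfolding law(1)[OF Km, symmetric] law(1)[OF free, symmetric] qs .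
    then show "(\<integral>s. ?F s \<partial>evolved_law \<psi> (\<lambda>_. free_field) ?\<mu>) = (\<integral>s. ?F s \<partial>?\<mu>)"
      by (simp add: LIMSEQ_const_iff)
  qed
  then show ?thesis by (simp add: freely_quasi_stationary_def)
qed

end
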